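(* Let $n,p$ be positive integers with $p \ge n$, let $X\in\mathbb{R}^{n\times p}$ have columns normalized so that $\|X_j\|_2=\sqrt n$ for all $1\le j\le p$, and let $y = X\beta_\star+z$ with $z\sim\mathcal{N}(0,\sigma^2 I_n)$, where $\beta_\star$ has support $J_\star$ of size $s_\star$ with $1\le s_\star\le\overline{s}$. Let $\varepsilon>0$ and $c\ge1$, and suppose that Condition $\mathbf{I}((2+\varepsilon)s_\star)$ holds, that the sparsity parameter of the prior is $$\lambda=\frac{1+\varepsilon}{\varepsilon}(23+5c)\log p,$$ and that $$\min_{j\in J_\star}|\beta_{\star,j}|\ge\frac{3\sigma\sqrt{\lambda/n}}{\nu_{(2+\varepsilon)s_\star}}.$$ Then, with probability at least $1-7p^{-c}$, $$\|\widehat\beta_{\rm map}-\beta_\star\|_\infty\le\sigma\sqrt{\frac{2(c+1)\log p}{n\,\nu_{s_\star}^2}}.$$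
   Context: Model: $y=X\beta_\star+z\in\mathbb{R}^n$ with $X\in\mathbb{R}^{n\times p}$ deterministic, $z\sim\mathcal{N}(0,\sigma^2 I_n)$ and $\sigma>0$ known. The vector $\beta_\star\in\mathbb{R}^p$ is one of the vectors $\beta$ of minimal support size among those satisfying $X\beta=\mathbb{E}(y)$; $J_\star\subset[p]:=\{1,\dots,p\}$ is its support and $s_\star=|J_\star|$. $\|\cdot\|_2$ is the Euclidean norm and $\|u\|_\infty=\max_j|u_j|$. For $J\subset[p]$, $X_J$ is the submatrix of $X$ with columns $X_j$, $j\in J$; $P_J$ is the orthogonal projection of $\mathbb{R}^n$ onto the span of $\{X_j: j\in J\}$, and $P_J^\perp=I_n-P_J$. Prior and pseudo-posterior: fix an integer upper bound $\overline{s}\le p$ on the support size (with $s_\star\le\overline{s}$) and a parameter $\lambda>0$. The prior on subsets $J\subset[p]$ is the probability distribution $\pi(J)\propto\binom{p}{|J|}^{-1}e^{-\lambda|J|}\mathbf{1}_{\{|J|\le\overline{s}\}}$, and the pseudo-posterior is the probability distribution $\Pi(J)\propto\pi(J)\exp\left(-\frac{\|P_J^\perp y\|_2^2}{2\sigma^2}\right)$. Estimator: for $J\subset[p]$, $\widehat\beta_J$ is the minimum-Euclidean-norm least squares coefficient vector for regressing $y$ on $X_J$, viewed as a vector of $\mathbb{R}^p$ by setting coordinates outside $J$ to $0$. $\widehat J_{\rm map}\in\arg\max_J\Pi(J)$ and $\widehat\beta_{\rm map}=\widehat\beta_{\widehat J_{\rm map}}$. Condition $\mathbf{I}(s)$ (for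 real $s\ge1$): for every $J\subset[p]$ with $|J|\le s$, $X_J$ has full column rank. Also, for real $s\ge1$, $$\nu_s=\min_{J\subset[p],\,1\le|J|\le s}\ \min_{u\in\mathbb{R}^{|J|},\,\|u\|_2=1}\frac1{\sqrt n}\|X_Ju\|_2,$$ so that $\mathbf{I}(s)$ is equivalent to $\nu_s>0$. *)

theory Defs
  imports "HOL-Probability.Probability"
begin

text \<open>
  The index types \<open>'n\<close> and \<open>'p\<close> play the roles of \<open>{1..n}\<close> and \<open>{1..p}\<close>. The submatrix of \<open>X\<close> with
  columns in \<open>J\<close> keeps its shape, the columns outside \<open>J\<close> being set to zero, and vectors of
  \<open>\<real>\<^sup>J\<close> are the vectors indexed by \<open>'p\<close> that vanish outside \<open>J\<close>.
\<close>

definition vec_supp :: "real ^ 'p \<Rightarrow> 'p set" where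
  "vec_supp b = {j. b $ j \<noteq> 0}"

definition sparsest_solution :: "real ^ 'p ^ 'n \<Rightarrow> real ^ 'n \<Rightarrow> real ^ 'p \<Rightarrow> bool" where
  "sparsest_solution X \<mu> b \<longleftrightarrow>
     is_arg_min (\<lambda>b'. card (vec_supp b')) (\<lambda>b'. X *v b' = \<mu>) b"

definition restrict_cols :: "real ^ 'p ^ 'n \<Rightarrow> 'p set \<Rightarrow> real ^ 'p ^ 'n" where
  "restrict_cols X J = (\<chi> i j. if j \<in> J then X $ i $ j else 0)"

definition proj_cols :: "real ^ 'p ^ 'n \<Rightarrow> 'p set \<Rightarrow> real ^ 'n \<Rightarrow> real ^ 'n" where
  "proj_cols X J v =
     (THE w. w \<in> span ((\<lambda>j. column j X) ` J) \<and>
             (\<forall>u \<in> span ((\<lambda>j. column j X) ` J). orthogonal (v - w) u))"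

definition full_column_rank :: "real ^ 'p ^ 'n \<Rightarrow> 'p set \<Rightarrow> bool" where
  "full_column_rank X J \<longleftrightarrow> rank (restrict_cols X J) = card J"

definition condition_I :: "real ^ 'p ^ 'n \<Rightarrow> real \<Rightarrow> bool" where
  "condition_I X s \<longleftrightarrow> (\<forall>J. real (card J) \<le> s \<longrightarrow> full_column_rank X J)"

text \<open>
  Both infima below are attained: the outer one ranges over finitely many \<open>J\<close>, the inner one
  over a compact sphere.
\<close>

definition nu :: "real ^ 'p ^ 'n \<Rightarrow> real \<Rightarrow> real" where
  "nu X s =
     (INF J \<in> {J. 1 \<le> card J \<and> real (card J) \<le> s}.
        INF u \<in> {u. vec_supp u \<subseteq> J \<and> norm u = 1}.
          1 / sqrt (real CARD('n)) * norm (restrict_cols X J *v u))"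

definition prior_weight :: "nat \<Rightarrow> real \<Rightarrow> ('p::finite) set \<Rightarrow> real" where
  "prior_weight sbar lam J =
     1 / real (CARD('p) choose card J) * exp (- lam * real (card J)) *
     (if card J \<le> sbar then 1 else 0)"

definition prior :: "nat \<Rightarrow> real \<Rightarrow> ('p::finite) set \<Rightarrow> real" where
  "prior sbar lam J = prior_weight sbar lam J / (\<Sum>K\<in>UNIV. prior_weight sbar lam (K :: 'p set))"

definition posterior_weight ::
    "real ^ 'p ^ 'n \<Rightarrow> real \<Rightarrow> nat \<Rightarrow> real \<Rightarrow> real ^ 'n \<Rightarrow> 'p set \<Rightarrow> real" where
  "posterior_weight X \<sigma> sbar lam y J =
     prior sbar lam J * exp (- (norm (y - proj_cols X J y))\<^sup>2 / (2 * \<sigma>\<^sup>2))"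

definition posterior ::
    "real ^ 'p ^ 'n \<Rightarrow> real \<Rightarrow> nat \<Rightarrow> real \<Rightarrow> real ^ 'n \<Rightarrow> 'p set \<Rightarrow> real" where
  "posterior X \<sigma> sbar lam y J =
     posterior_weight X \<sigma> sbar lam y J / (\<Sum>K\<in>UNIV. posterior_weight X \<sigma> sbar lam y K)"

definition least_squares :: "real ^ 'p ^ 'n \<Rightarrow> 'p set \<Rightarrow> real ^ 'n \<Rightarrow> real ^ 'p \<Rightarrow> bool" where
  "least_squares X J y b \<longleftrightarrow>
     is_arg_min (\<lambda>b'. norm (y - restrict_cols X J *v b')) (\<lambda>b'. vec_supp b' \<subseteq> J) b"

definition beta_hat :: "real ^ 'p ^ 'n \<Rightarrow> 'p set \<Rightarrow> real ^ 'n \<Rightarrow> real ^ 'p" where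
  "beta_hat X J y = (ARG_MIN norm b. least_squares X J y b)"

definition isotropic_gaussian :: "'a measure \<Rightarrow> real \<Rightarrow> ('a \<Rightarrow> real ^ 'n) \<Rightarrow> bool" where
  "isotropic_gaussian M \<sigma> z \<longleftrightarrow>
     distributed M lborel z (\<lambda>x. ennreal (\<Prod>i\<in>UNIV. normal_density 0 \<sigma> (x $ i)))"

end

theory Submission
  imports Defs
begin

text \<open>
  Write \<open>J\<^sub>*\<close> for the true support and \<open>\<mu> = X \<beta>\<^sub>*\<close>. For a competitor \<open>J\<close> with \<open>t\<close> false and \<open>k\<close> missing
  indices, the residual \<open>\<parallel>P\<^sub>J\<^sup>\<bottom> y\<parallel>\<^sup>2 - \<parallel>P\<^bsub>J*\<^esub>\<^sup>\<bottom> y\<parallel>\<^sup>2\<close> is at least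
  \<open>\<parallel>v\<parallel>\<^sup>2 + 2 \<langle>v, z\<rangle> - W\<close> with \<open>v = P\<^sub>J\<^sup>\<bottom> \<mu>\<close> and \<open>W\<close> a chi-square of at most \<open>t\<close> degrees of freedom, and
  also at least \<open>- W\<close>. Union bounds over the symmetric difference of \<open>J\<close> and \<open>J\<^sub>*\<close> control \<open>W\<close> by
  \<open>\<sigma>\<^sup>2 t log p\<close> and \<open>\<langle>v, z\<rangle>\<close> by \<open>\<sigma> \<parallel>v\<parallel> sqrt ((t + k) log p)\<close>, up to constants. If \<open>|J| > (1 + \<epsilon>) s\<^sub>*\<close>,
  the penalty \<open>\<lambda> (|J| - s\<^sub>*)\<close> alone beats the noise; otherwise \<open>|J \<union> J\<^sub>*| \<le> (2 + \<epsilon>) s\<^sub>*\<close> and the signal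
  condition gives \<open>\<parallel>v\<parallel>\<^sup>2 \<ge> 9 \<sigma>\<^sup>2 \<lambda> k\<close>, which beats the reward \<open>\<lambda> k\<close> for the missing indices. So the MAP
  is \<open>J\<^sub>*\<close>, and the coordinates of the least squares error are Gaussian of variance at most
  \<open>\<sigma>\<^sup>2 / (n \<nu>\<^sup>2)\<close>.
\<close>

subsection \<open>Projections and restricted eigenvalues\<close>

abbreviation col_space :: "real ^ 'p ^ 'n \<Rightarrow> 'p set \<Rightarrow> (real ^ 'n) set" where
  "col_space X J \<equiv> span ((\<lambda>j. column j X) ` J)"

lemma restrict_cols_mult:
  assumes "vec_supp b \<subseteq> J"
  shows "restrict_cols X J *v b = X *v b"
proof -
  have "b $ j = 0" if "j \<notin> J" for j
    using assms that by (auto simp: vec_supp_def)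
  then show ?thesis
    by (auto simp: restrict_cols_def matrix_vector_mult_def vec_eq_iff intro!: sum.cong)
qed

lemma subspace_vec_supp: "subspace {b. vec_supp b \<subseteq> J}"
proof -
  have "{b. vec_supp b \<subseteq> J} = {b. \<forall>j. j \<notin> J \<longrightarrow> b $ j = 0}"
    by (auto simp: vec_supp_def)
  then show ?thesis
    by (auto simp: subspace_def)
qed

lemma col_space_eq:
  fixes X :: "real ^ 'p ^ 'n"
  shows "col_space X J = (*v) X ` {b. vec_supp b \<subseteq> J}"
proof
  have "column j X \<in> (*v) X ` {b. vec_supp b \<subseteq> J}" if "j \<in> J" for j
  proof -
    have "vec_supp (axis j 1) \<subseteq> J"
      using that by (auto simp: vec_supp_def axis_def)
    then show ?thesis
      by (metis imageI matrix_vector_mult_basis mem_Collect_eq)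
  qed
  moreover have "subspace ((*v) X ` {b. vec_supp b \<subseteq> J})"
    by (intro linear_subspace_image matrix_vector_mul_linear subspace_vec_supp)
  ultimately show "col_space X J \<subseteq> (*v) X ` {b. vec_supp b \<subseteq> J}"
    by (intro span_minimal) auto
next
  show "(*v) X ` {b. vec_supp b \<subseteq> J} \<subseteq> col_space X J"
  proof clarify
    fix b :: "real ^ 'p" assume b: "vec_supp b \<subseteq> J"
    have "X *v b = (\<Sum>j\<in>UNIV. b $ j *\<^sub>R column j X)"
      by (simp add: matrix_mult_sum scalar_mult_eq_scaleR)
    also have "\<dots> = (\<Sum>j\<in>J. b $ j *\<^sub>R column j X)"
      using b by (intro sum.mono_neutral_right) (auto simp: vec_supp_def)
    also have "\<dots> \<in> col_space X J"
      by (intro span_sum span_scale span_base) auto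
    finally show "X *v b \<in> col_space X J" .
  qed
qed

text \<open>\<open>proj_cols\<close> is a definite description, and this is how it gets evaluated:
  two candidates differ by a vector of the span that is orthogonal to itself.\<close>

lemma proj_cols_unique:
  assumes "w \<in> col_space X J" "\<And>u. u \<in> col_space X J \<Longrightarrow> orthogonal (v - w) u"
  shows "proj_cols X J v = w"
  unfolding proj_cols_def
proof (rule the_equality)
  show "w \<in> col_space X J \<and> (\<forall>u\<in>col_space X J. orthogonal (v - w) u)"
    using assms by blast
next
  fix w' assume w': "w' \<in> col_space X J \<and> (\<forall>u\<in>col_space X J. orthogonal (v - w') u)"
  then have "w' - w \<in> col_space X J"
    using assms(1) by (simp add: span_diff)
  then have "(v - w) \<bullet> (w' - w) = 0" "(v - w') \<bullet> (w' - w) = 0"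
    using assms(2) w' by (auto simp: orthogonal_def)
  then have "(w' - w) \<bullet> (w' - w) = 0"
    by (simp add: inner_diff_left)
  then show "w' = w" by simp
qed

lemma proj_cols_ex:
  "proj_cols X J v \<in> col_space X J \<and> (\<forall>u\<in>col_space X J. (v - proj_cols X J v) \<bullet> u = 0)"
proof -
  obtain w r where w: "w \<in> col_space X J" "\<And>u. u \<in> col_space X J \<Longrightarrow> orthogonal r u" "v = w + r"
    using orthogonal_subspace_decomp_exists by blast
  then have "proj_cols X J v = w"
    by (intro proj_cols_unique) auto
  with w show ?thesis
    by (auto simp: orthogonal_def)
qed

lemma proj_cols_in: "proj_cols X J v \<in> col_space X J"
  using proj_cols_ex by blast

lemma inner_proj_cols_residual:
  "u \<in> col_space X J \<Longrightarrow> (v - proj_cols X J v) \<bullet> u = 0"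
  using proj_cols_ex by blast

lemma proj_cols_add: "proj_cols X J (u + v) = proj_cols X J u + proj_cols X J v"
proof (rule proj_cols_unique)
  fix w assume "w \<in> col_space X J"
  then have "(u - proj_cols X J u) \<bullet> w + (v - proj_cols X J v) \<bullet> w = 0"
    by (simp add: inner_proj_cols_residual)
  then show "orthogonal (u + v - (proj_cols X J u + proj_cols X J v)) w"
    by (simp add: orthogonal_def inner_diff_left inner_add_left)
qed (simp add: span_add proj_cols_in)

lemma proj_cols_scaleR: "proj_cols X J (r *\<^sub>R v) = r *\<^sub>R proj_cols X J v"
proof (rule proj_cols_unique)
  fix w assume "w \<in> col_space X J"
  then have "(v - proj_cols X J v) \<bullet> w = 0"
    by (simp add: inner_proj_cols_residual)
  then show "orthogonal (r *\<^sub>R v - r *\<^sub>R proj_cols X J v) w"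
    by (simp add: orthogonal_def flip: scaleR_diff_right)
qed (simp add: span_scale proj_cols_in)

lemma linear_proj_cols: "linear (proj_cols X J)"
  by (simp add: linear_iff proj_cols_add proj_cols_scaleR)

lemma proj_cols_self: "v \<in> col_space X J \<Longrightarrow> proj_cols X J v = v"
  by (rule proj_cols_unique) (auto simp: orthogonal_def)

lemma proj_cols_pythagoras:
  assumes "u \<in> col_space X J"
  shows "(norm (v - u))\<^sup>2 = (norm (v - proj_cols X J v))\<^sup>2 + (norm (proj_cols X J v - u))\<^sup>2"
proof -
  have "orthogonal (v - proj_cols X J v) (proj_cols X J v - u)"
    using assms by (simp add: orthogonal_def inner_proj_cols_residual proj_cols_in span_diff)
  from norm_add_Pythagorean[OF this] show ?thesis by simp
qed

lemma norm_proj_cols_le: "norm (proj_cols X J v) \<le> norm v"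
proof -
  have "(norm (proj_cols X J v))\<^sup>2 \<le> (norm v)\<^sup>2"
    using proj_cols_pythagoras[OF span_zero, where v = v and X = X and J = J] by simp
  then show ?thesis by (simp add: power2_le_iff_abs_le)
qed

lemma residual_antimono:
  assumes "J \<subseteq> K"
  shows "(norm (v - proj_cols X K v))\<^sup>2 \<le> (norm (v - proj_cols X J v))\<^sup>2"
proof -
  have "proj_cols X J v \<in> col_space X K"
    using proj_cols_in span_mono[OF image_mono[OF assms]] by blast
  from proj_cols_pythagoras[OF this, of v] show ?thesis by simp
qed

lemma dim_col_space_Un: "dim (col_space X (J \<union> T)) \<le> dim (col_space X J) + card T"
proof -
  have "finite T" by simp
  then show ?thesis
  proof (induction T)
    case (insert t T)
    have "(\<lambda>j. column j X) ` (J \<union> insert t T) = insert (column t X) ((\<lambda>j. column j X) ` (J \<union> T))"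
      by auto
    then have "dim (col_space X (J \<union> insert t T)) \<le> dim (col_space X (J \<union> T)) + 1"
      by (simp add: dim_insert)
    with insert show ?case by simp
  qed simp
qed

text \<open>\<open>B\<close> is an orthonormal basis of the orthogonal complement of
  \<open>col_space X J\<close> inside \<open>col_space X (J \<union> T)\<close>. The residual drops
  by the squared norm of the difference of the two projections, which Parseval expands in
  \<open>B\<close>. Since \<open>B\<close> is chosen before \<open>x\<close>, a Gaussian
  \<open>x\<close> makes the sum a chi-square variable up to scale.\<close>

lemma residual_orthonormal_increment:
  obtains B where "finite B" "pairwise orthogonal B" "\<And>e. e \<in> B \<Longrightarrow> norm e = 1" "card B \<le> card T"
    "\<And>x. (norm (x - proj_cols X J x))\<^sup>2
          = (norm (x - proj_cols X (J \<union> T) x))\<^sup>2 + (\<Sum>e\<in>B. (e \<bullet> x)\<^sup>2)"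
proof -
  define U where "U = col_space X J"
  define S where "S = col_space X (J \<union> T)"
  define D where "D = {y \<in> S. \<forall>x\<in>U. orthogonal x y}"
  have US: "U \<subseteq> S" unfolding U_def S_def by (intro span_mono) auto
  have "subspace D"
    unfolding D_def S_def
    by (auto simp: subspace_def span_zero span_add span_scale orthogonal_def inner_add_right)
  then obtain B where B: "B \<subseteq> D" "pairwise orthogonal B" "\<And>x. x \<in> B \<Longrightarrow> norm x = 1"
    "independent B" "card B = dim D" "span B = D"
    using orthonormal_basis_subspace by blast
  have fin: "finite B"
    using B(4) by (simp add: independent_imp_finite)
  have "dim D + dim U = dim S"
    unfolding D_def using US by (intro dim_subspace_orthogonal_to_vectors) (auto simp: U_def S_def)
  with dim_col_space_Un[of X J T] have "card B \<le> card T"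
    unfolding B(5) U_def S_def by linarith
  moreover have "(norm (x - proj_cols X J x))\<^sup>2
      = (norm (x - proj_cols X (J \<union> T) x))\<^sup>2 + (\<Sum>e\<in>B. (e \<bullet> x)\<^sup>2)" for x
  proof -
    define d where "d = proj_cols X (J \<union> T) x - proj_cols X J x"
    have PU: "proj_cols X J x \<in> U" unfolding U_def by (rule proj_cols_in)
    have "d \<in> S"
      using PU US unfolding d_def S_def by (intro span_diff proj_cols_in) auto
    moreover have "u \<bullet> d = 0" if "u \<in> U" for u
    proof -
      have "(x - proj_cols X J x) \<bullet> u = 0" "(x - proj_cols X (J \<union> T) x) \<bullet> u = 0"
        using that US unfolding U_def S_def by (auto intro!: inner_proj_cols_residual)
      then show ?thesis
        by (simp add: d_def inner_commute[of u] inner_diff_left)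
    qed
    ultimately have "d \<in> span B"
      by (simp add: B(6) D_def orthogonal_def)
    have "(norm d)\<^sup>2 = d \<bullet> (\<Sum>e\<in>B. (d \<bullet> e) *\<^sub>R e)"
      using orthonormal_basis_expand[OF B(2,3) \<open>d \<in> span B\<close> fin] by (simp add: power2_norm_eq_inner)
    also have "\<dots> = (\<Sum>e\<in>B. (d \<bullet> e)\<^sup>2)"
      by (simp add: inner_sum_right power2_eq_square)
    also have "\<dots> = (\<Sum>e\<in>B. (e \<bullet> x)\<^sup>2)"
    proof (rule sum.cong)
      fix e assume "e \<in> B"
      with B(1) have e: "e \<in> S" "proj_cols X J x \<bullet> e = 0"
        using PU by (auto simp: D_def orthogonal_def)
      have "(x - proj_cols X (J \<union> T) x) \<bullet> e = 0"
        using e(1) unfolding S_def by (rule inner_proj_cols_residual)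
      with e(2) have "d \<bullet> e = e \<bullet> x"
        by (simp add: d_def inner_diff_left inner_diff_right inner_commute)
      then show "(d \<bullet> e)\<^sup>2 = (e \<bullet> x)\<^sup>2" by simp
    qed simp
    finally show ?thesis
      using proj_cols_pythagoras[of "proj_cols X J x" X "J \<union> T" x] PU US
      by (simp add: d_def S_def subset_iff)
  qed
  ultimately show thesis
    using that[of B] fin B by blast
qed

section \<open>Injectivity of submatrices and the restricted eigenvalue\<close>

text \<open>A nonzero kernel vector supported in \<open>J\<close> makes one column redundant, so the
  rank falls below \<open>card J\<close>.\<close>

lemma full_column_rank_inj:
  fixes X :: "real ^ 'p ^ 'n"
  assumes "full_column_rank X J" "vec_supp b \<subseteq> J" "X *v b = 0"
  shows "b = 0"
proof (rule ccontr)
  assume "b \<noteq> 0"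
  then obtain j where j: "b $ j \<noteq> 0" by (auto simp: vec_eq_iff)
  then have jJ: "j \<in> J" using assms(2) by (auto simp: vec_supp_def)
  \<comment> \<open>Solves the relation \<open>X *v b = 0\<close> for column \<open>j\<close>: the
    image of \<open>a\<close> is that column, yet the coefficient of \<open>a\<close> at
    \<open>j\<close> is zero.\<close>
  define a where "a = axis j 1 - (1 / b $ j) *\<^sub>R b"
  have "vec_supp a \<subseteq> J - {j}"
    using assms(2) j by (auto simp: vec_supp_def a_def axis_def split: if_splits)
  moreover have "X *v a = column j X"
    by (simp add: a_def matrix_vector_mult_diff_distrib matrix_vector_mult_basis
        matrix_vector_mult_scaleR assms(3))
  ultimately have "column j X \<in> col_space X (J - {j})"
    unfolding col_space_eq by (metis imageI mem_Collect_eq)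
  moreover have "(\<lambda>j. column j X) ` J = insert (column j X) ((\<lambda>j. column j X) ` (J - {j}))"
    using jJ by auto
  ultimately have eq: "col_space X J = col_space X (J - {j})"
    by (simp add: span_redundant)
  have "range ((*v) (restrict_cols X J)) \<subseteq> col_space X J"
  proof clarify
    fix u :: "real ^ 'p"
    have "restrict_cols X J *v u = X *v (\<chi> i. if i \<in> J then u $ i else 0)"
      by (auto simp: restrict_cols_def matrix_vector_mult_def vec_eq_iff intro!: sum.cong)
    moreover have "vec_supp (\<chi> i. if i \<in> J then u $ i else 0) \<subseteq> J"
      by (auto simp: vec_supp_def)
    ultimately show "restrict_cols X J *v u \<in> col_space X J"
      unfolding col_space_eq by auto
  qed
  then have "card J \<le> dim (col_space X (J - {j}))"
    using assms(1) dim_subset unfolding full_column_rank_def rank_dim_range eq by metis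
  also have "\<dots> \<le> card ((\<lambda>j. column j X) ` (J - {j}))"
    by (simp add: dim_le_card')
  also have "\<dots> \<le> card (J - {j})"
    by (rule card_image_le) simp
  also have "\<dots> < card J"
    using jJ by (meson card_Diff1_less finite)
  finally show False by simp
qed

lemma sphere_vec_supp_ne:
  assumes "1 \<le> card J"
  shows "{u :: real ^ 'p. vec_supp u \<subseteq> J \<and> norm u = 1} \<noteq> {}"
proof -
  obtain j where "j \<in> J" using assms by fastforce
  then have "axis j 1 \<in> {u :: real ^ 'p. vec_supp u \<subseteq> J \<and> norm u = 1}"
    by (auto simp: vec_supp_def axis_def norm_axis_1 [unfolded axis_def] split: if_splits)
  then show ?thesis by blast
qed

lemma nu_le:
  fixes X :: "real ^ 'p ^ 'n"
  assumes "vec_supp u \<subseteq> J" "real (card J) \<le> s"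
  shows "nu X s * sqrt (real CARD('n)) * norm u \<le> norm (X *v u)"
\<comment> \<open>For \<open>u = 0\<close> both sides vanish; otherwise \<open>J\<close> is
  nonempty, as the index set of the outer infimum demands.\<close>
proof (cases "u = 0")
  case False
  then have "J \<noteq> {}" using assms(1) by (auto simp: vec_supp_def vec_eq_iff)
  then have J: "1 \<le> card J" by (simp add: Suc_le_eq card_gt_0_iff)
  define f where "f J u = 1 / sqrt (real CARD('n)) * norm (restrict_cols X J *v u)" for J u
  define A where "A J = {u :: real ^ 'p. vec_supp u \<subseteq> J \<and> norm u = 1}" for J
  have f0: "0 \<le> f K v" for K v by (simp add: f_def)
  have bA: "bdd_below (f K ` A K)" for K
    using f0 by (auto intro!: bdd_belowI[of _ 0])
  have v: "(1 / norm u) *\<^sub>R u \<in> A J"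
    using assms(1) False by (auto simp: A_def vec_supp_def)
  have "nu X s = (INF J \<in> {J. 1 \<le> card J \<and> real (card J) \<le> s}. INF u \<in> A J. f J u)"
    by (simp add: nu_def A_def f_def)
  also have "\<dots> \<le> (INF u \<in> A J. f J u)"
  proof (rule cINF_lower)
    show "bdd_below ((\<lambda>J. \<Sqinter> (f J ` A J)) ` {J. 1 \<le> card J \<and> real (card J) \<le> s})"
      by (rule bdd_below_finite) simp
  qed (use J assms(2) in auto)
  also have "\<dots> \<le> f J ((1 / norm u) *\<^sub>R u)"
    by (rule cINF_lower[OF bA v])
  also have "\<dots> = norm (X *v u) / (sqrt (real CARD('n)) * norm u)"
    using False by (simp add: f_def matrix_vector_mult_scaleR restrict_cols_mult[OF assms(1)])
  finally show ?thesis
    using False by (simp add: field_simps)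
qed simp

text \<open>The unit sphere of each coordinate subspace is compact, so the inner infimum is
  attained, and it is positive by injectivity; the outer infimum is a minimum over finitely many
  sets.\<close>

lemma nu_pos:
  fixes X :: "real ^ 'p ^ 'n"
  assumes I: "condition_I X s" and s: "1 \<le> s"
  shows "nu X s > 0"
proof -
  define f where "f J u = 1 / sqrt (real CARD('n)) * norm (restrict_cols X J *v u)" for J u
  define A where "A J = {u :: real ^ 'p. vec_supp u \<subseteq> J \<and> norm u = 1}" for J
  define F where "F = {J :: 'p set. 1 \<le> card J \<and> real (card J) \<le> s}"
  have pos: "(INF u \<in> A J. f J u) > 0" if J: "J \<in> F" for J
  proof -
    have "A J = sphere 0 1 \<inter> {u. vec_supp u \<subseteq> J}"
      by (auto simp: A_def)
    then have "compact (A J)"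
      by (simp add: compact_Int_closed closed_subspace subspace_vec_supp)
    moreover have ne: "A J \<noteq> {}"
      using J sphere_vec_supp_ne unfolding A_def F_def by blast
    moreover have "continuous_on (A J) (f J)"
      unfolding f_def by (intro continuous_intros linear_continuous_on_compose[OF continuous_on_id]
          matrix_vector_mul_linear)
    ultimately obtain u where u: "u \<in> A J" "\<And>v. v \<in> A J \<Longrightarrow> f J u \<le> f J v"
      using continuous_attains_inf by metis
    have "f J u > 0"
    proof -
      have "X *v u \<noteq> 0"
        using full_column_rank_inj[of X J u] u(1) J I by (auto simp: A_def F_def condition_I_def)
      then show ?thesis
        using u(1) by (simp add: f_def A_def restrict_cols_mult)
    qed
    also have "f J u \<le> (INF u \<in> A J. f J u)"
      using u ne by (intro cINF_greatest) auto
    finally show ?thesis .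
  qed
  \<comment> \<open>An arbitrary singleton shows that the outer infimum is not over the empty set;
    this is where \<open>1 \<le> s\<close> enters.\<close>
  have "{undefined} \<in> F" using s by (simp add: F_def)
  then have "F \<noteq> {}" by blast
  then have "(INF J \<in> F. INF u \<in> A J. f J u) \<in> (\<lambda>J. INF u \<in> A J. f J u) ` F"
    by (simp add: cInf_eq_Min)
  moreover have "nu X s = (INF J \<in> F. INF u \<in> A J. f J u)"
    by (simp add: nu_def A_def f_def F_def)
  ultimately show ?thesis using pos by auto
qed

text \<open>\<open>L\<close> is the pseudo-inverse of the submatrix on \<open>J\<close>, padded with
  zeros: project onto the column span, then invert \<open>X\<close> there. Its norm bound combines
  the contraction property of the projection with the restricted eigenvalue.\<close>

lemma matrix_left_inverse_coordinates:
  fixes X :: "real ^ 'p ^ 'n"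
  assumes I: "condition_I X s" and J: "real (card J) \<le> s" and s: "1 \<le> s"
  obtains L where "linear L" "\<And>x. vec_supp (L x) \<subseteq> J"
    "\<And>x. X *v L x = proj_cols X J x"
    "\<And>b. vec_supp b \<subseteq> J \<Longrightarrow> L (X *v b) = b"
    "\<And>x. norm (L x) \<le> norm x / (sqrt (real CARD('n)) * nu X s)"
proof -
  define V where "V = {b :: real ^ 'p. vec_supp b \<subseteq> J}"
  have sub: "subspace V" unfolding V_def by (rule subspace_vec_supp)
  have "inj_on ((*v) X) V"
  proof (rule inj_onI)
    fix a b assume ab: "a \<in> V" "b \<in> V" "X *v a = X *v b"
    then have "a - b \<in> V" by (simp add: sub subspace_diff)
    moreover have "full_column_rank X J" using I J by (simp add: condition_I_def)
    ultimately have "a - b = 0"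
      using ab(3) by (intro full_column_rank_inj[of X J])
        (auto simp: V_def matrix_vector_mult_diff_distrib)
    then show "a = b" by simp
  qed
  then obtain g where g: "g ` UNIV \<subseteq> V" "linear g" "\<And>v. v \<in> V \<Longrightarrow> g (X *v v) = v"
    using linear_exists_left_inverse_on[OF matrix_vector_mul_linear sub] by metis
  define L where "L = g \<circ> proj_cols X J"
  have XL: "X *v L x = proj_cols X J x" for x
    using proj_cols_in[of X J x] g(3) unfolding col_space_eq L_def V_def by auto
  have supp: "vec_supp (L x) \<subseteq> J" for x
    using g(1) by (auto simp: L_def V_def)
  show thesis
  proof
    show "linear L" unfolding L_def by (intro linear_compose linear_proj_cols g)
    show "L (X *v b) = b" if "vec_supp b \<subseteq> J" for b
    proof -
      have "X *v b \<in> col_space X J" using that by (auto simp: col_space_eq)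
      then show ?thesis using that by (simp add: L_def proj_cols_self g(3) V_def)
    qed
    show "norm (L x) \<le> norm x / (sqrt (real CARD('n)) * nu X s)" for x
    proof -
      have "nu X s * sqrt (real CARD('n)) * norm (L x) \<le> norm x"
        using nu_le[OF supp[of x] J, of X] norm_proj_cols_le[of X J x] by (simp add: XL)
      then show ?thesis
        using nu_pos[OF I s] by (simp add: field_simps)
    qed
  qed (fact XL supp)+
qed

section \<open>The least squares estimator on a fixed support\<close>

text \<open>By Pythagoras a least squares vector must map to the projection of \<open>y\<close>, and
  the left inverse leaves only \<open>L y\<close>. The minimum-norm choice is thus made among a
  single candidate.\<close>

lemma beta_hat_eq:
  assumes "linear L" "\<And>x. vec_supp (L x) \<subseteq> J" "\<And>x. X *v L x = proj_cols X J x"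
    "\<And>b. vec_supp b \<subseteq> J \<Longrightarrow> L (X *v b) = b"
  shows "beta_hat X J y = L y"
proof -
  have pyth: "(norm (y - restrict_cols X J *v b))\<^sup>2
      = (norm (y - proj_cols X J y))\<^sup>2 + (norm (proj_cols X J y - X *v b))\<^sup>2"
    if "vec_supp b \<subseteq> J" for b
    using that by (subst restrict_cols_mult[OF that], intro proj_cols_pythagoras)
      (auto simp: col_space_eq)
  have "least_squares X J y b \<longleftrightarrow> b = L y" for b
  proof
    assume ls: "least_squares X J y b"
    then have b: "vec_supp b \<subseteq> J"
      by (simp add: least_squares_def is_arg_min_def)
    from ls have "norm (y - restrict_cols X J *v b) \<le> norm (y - restrict_cols X J *v L y)"
      using assms(2)[of y] unfolding least_squares_def is_arg_min_def by (meson not_le)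
    then have "(norm (y - restrict_cols X J *v b))\<^sup>2 \<le> (norm (y - restrict_cols X J *v L y))\<^sup>2"
      by (simp add: power_mono)
    then have "(norm (proj_cols X J y - X *v b))\<^sup>2 \<le> 0"
      using pyth[OF b] pyth[OF assms(2)[of y]] by (simp add: assms(3))
    then have "X *v b = X *v L y" by (simp add: assms(3))
    then show "b = L y" using assms(2,4) b by metis
  next
    assume b: "b = L y"
    have "norm (y - restrict_cols X J *v L y) \<le> norm (y - restrict_cols X J *v b')"
      if "vec_supp b' \<subseteq> J" for b'
    proof -
      have "(norm (y - restrict_cols X J *v L y))\<^sup>2 \<le> (norm (y - restrict_cols X J *v b'))\<^sup>2"
        using pyth[OF that] pyth[OF assms(2)[of y]] by (simp add: assms(3))
      then show ?thesis by (simp add: power2_le_iff_abs_le)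
    qed
    then show "least_squares X J y b"
      using assms(2) unfolding least_squares_def is_arg_min_def b by (auto simp: not_less)
  qed
  then have "beta_hat X J y = (ARG_MIN norm b. b = L y)"
    by (simp add: beta_hat_def)
  then show ?thesis
    by (metis (mono_tags, lifting) arg_min_def is_arg_min_def someI_ex less_irrefl)
qed

subsection \<open>Gaussian tail bounds\<close>

lemma nn_integral_normal_density:
  assumes "s > 0"
  shows "(\<integral>\<^sup>+x. ennreal (normal_density m s x) \<partial>lborel) = 1"
proof -
  have "emeasure (density lborel (normal_density m s)) (space (density lborel (normal_density m s))) = 1"
    by (rule prob_space.emeasure_space_1) (rule prob_space_normal_density[OF assms])
  then show ?thesis by (simp add: emeasure_density)
qed

text \<open>Completing the square gives a constant times the normal density centred at
  \<open>s\<^sup>2 * a\<close>.\<close>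

lemma nn_integral_normal_density_exp:
  assumes "s > 0"
  shows "(\<integral>\<^sup>+x. ennreal (normal_density 0 s x * exp (a * x)) \<partial>lborel) = ennreal (exp (s\<^sup>2 * a\<^sup>2 / 2))"
proof -
  have "normal_density 0 s x * exp (a * x) = exp (s\<^sup>2 * a\<^sup>2 / 2) * normal_density (s\<^sup>2 * a) s x" for x
  proof -
    have "- (x\<^sup>2) / (2 * s\<^sup>2) + a * x = s\<^sup>2 * a\<^sup>2 / 2 - (x - s\<^sup>2 * a)\<^sup>2 / (2 * s\<^sup>2)"
      using assms by (simp add: field_simps power2_eq_square)
    then have "exp (- (x\<^sup>2) / (2 * s\<^sup>2)) * exp (a * x)
        = exp (s\<^sup>2 * a\<^sup>2 / 2) * exp (- (x - s\<^sup>2 * a)\<^sup>2 / (2 * s\<^sup>2))"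
      by (simp flip: exp_add)
    then show ?thesis by (simp add: normal_density_def)
  qed
  then show ?thesis
    by (simp add: ennreal_mult' normal_density_nonneg nn_integral_cmult nn_integral_normal_density[OF assms])
qed

text \<open>The factor \<open>exp (x\<^sup>2 / 4)\<close> doubles the variance: completing the
  square leaves the normal density with mean \<open>2 * b\<close> and variance 2, and
  \<open>sqrt 2\<close> is the ratio of the normalisations.\<close>

lemma nn_integral_std_normal_exp_square:
  "(\<integral>\<^sup>+x. ennreal (normal_density 0 1 x * exp (b * x + x\<^sup>2 / 4)) \<partial>lborel)
     = ennreal (sqrt 2 * exp (b\<^sup>2))"
proof -
  have "normal_density 0 1 x * exp (b * x + x\<^sup>2 / 4)
      = sqrt 2 * exp (b\<^sup>2) * normal_density (2 * b) (sqrt 2) x" for x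
  proof -
    have "- (x\<^sup>2) / 2 + (b * x + x\<^sup>2 / 4) = b\<^sup>2 - (x - 2 * b)\<^sup>2 / 4"
      by (simp add: field_simps power2_eq_square)
    then have "exp (- (x\<^sup>2) / 2) * exp (b * x + x\<^sup>2 / 4) = exp (b\<^sup>2) * exp (- (x - 2 * b)\<^sup>2 / 4)"
      by (simp flip: exp_add)
    moreover have "1 / sqrt (2 * pi) = sqrt 2 / sqrt (2 * pi * 2)"
      by (metis mult.commute nonzero_divide_mult_cancel_left mult_1_right real_sqrt_mult
          real_sqrt_eq_0_iff zero_neq_numeral)
    ultimately show ?thesis by (simp add: normal_density_def)
  qed
  then show ?thesis
    by (simp add: ennreal_mult' normal_density_nonneg nn_integral_cmult nn_integral_normal_density)
qed

lemma isotropic_gaussian_measurable: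
  "isotropic_gaussian M \<sigma> z \<Longrightarrow> z \<in> borel_measurable M"
  by (auto simp: isotropic_gaussian_def distributed_def)

text \<open>Density and exponential both split over the coordinates, so the integral is a product of
  one-dimensional ones.\<close>

lemma isotropic_gaussian_mgf:
  fixes z :: "'a \<Rightarrow> real ^ 'n"
  assumes z: "isotropic_gaussian M \<sigma> z" and s: "\<sigma> > 0"
  shows "(\<integral>\<^sup>+\<omega>. ennreal (exp (v \<bullet> z \<omega>)) \<partial>M) = ennreal (exp (\<sigma>\<^sup>2 * (norm v)\<^sup>2 / 2))"
proof -
  define f where "f b x = ennreal (normal_density 0 \<sigma> x * exp ((v \<bullet> b) * x))" for b x
  have Basis: "(Basis :: (real ^ 'n) set) = range (\<lambda>i. axis i 1)"
    by (auto simp: Basis_vec_def)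
  have inj: "inj (\<lambda>i::'n. axis i (1::real))"
    by (auto simp: inj_on_def axis_eq_axis)
  have prod_Basis: "(\<Prod>b\<in>Basis. h b) = (\<Prod>i\<in>UNIV. h (axis i 1))" for h :: "real ^ 'n \<Rightarrow> ennreal"
    unfolding Basis using inj by (subst prod.reindex) auto
  have "(\<integral>\<^sup>+\<omega>. ennreal (exp (v \<bullet> z \<omega>)) \<partial>M)
      = (\<integral>\<^sup>+x. ennreal (\<Prod>i\<in>UNIV. normal_density 0 \<sigma> (x $ i)) * ennreal (exp (v \<bullet> x)) \<partial>lborel)"
    by (rule distributed_nn_integral[symmetric, where g = "\<lambda>x. ennreal (exp (v \<bullet> x))"])
      (use z in \<open>auto simp: isotropic_gaussian_def\<close>)
  also have "\<dots> = (\<integral>\<^sup>+x. (\<Prod>b\<in>Basis. f b (x \<bullet> b)) \<partial>lborel)"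
  proof (rule nn_integral_cong)
    fix x :: "real ^ 'n"
    have "ennreal (\<Prod>i\<in>UNIV. normal_density 0 \<sigma> (x $ i)) * ennreal (exp (v \<bullet> x))
       = ennreal (\<Prod>i\<in>UNIV. normal_density 0 \<sigma> (x $ i) * exp (v $ i * x $ i))"
      by (simp add: prod.distrib exp_sum inner_vec_def ennreal_mult' prod_nonneg normal_density_nonneg)
    also have "\<dots> = (\<Prod>b\<in>Basis. f b (x \<bullet> b))"
      by (simp add: prod_Basis f_def inner_axis prod_ennreal normal_density_nonneg)
    finally show "ennreal (\<Prod>i\<in>UNIV. normal_density 0 \<sigma> (x $ i)) * ennreal (exp (v \<bullet> x))
       = (\<Prod>b\<in>Basis. f b (x \<bullet> b))" .
  qed
  also have "\<dots> = (\<Prod>b\<in>Basis. (\<integral>\<^sup>+x. f b x \<partial>lborel))"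
    by (rule nn_integral_lborel_prod) (auto simp: f_def)
  also have "\<dots> = (\<Prod>i\<in>UNIV. ennreal (exp (\<sigma>\<^sup>2 * (v $ i)\<^sup>2 / 2)))"
    by (simp add: prod_Basis f_def nn_integral_normal_density_exp[OF s] inner_axis)
  also have "\<dots> = ennreal (exp (\<sigma>\<^sup>2 * (norm v)\<^sup>2 / 2))"
  proof -
    have "(norm v)\<^sup>2 = (\<Sum>i\<in>UNIV. (v $ i)\<^sup>2)"
      by (simp add: power2_norm_eq_inner inner_vec_def) (simp add: power2_eq_square)
    then show ?thesis
      by (simp add: prod_ennreal sum_distrib_left flip: exp_sum sum_divide_distrib)
  qed
  finally show ?thesis .
qed

text \<open>
  The square is linearised by \<open>exp (x\<^sup>2 / 2) = E (exp (g * x))\<close> with \<open>g\<close> standard normal, so that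
  one orthonormal vector at a time can be absorbed into the linear term \<open>v\<close>.
\<close>

lemma isotropic_gaussian_mgf_squares:
  fixes z :: "'a \<Rightarrow> real ^ 'n"
  assumes M: "prob_space M" and z: "isotropic_gaussian M \<sigma> z" and s: "\<sigma> > 0"
    and B: "finite B" "pairwise orthogonal B" "\<And>e. e \<in> B \<Longrightarrow> norm e = 1"
  shows "(\<integral>\<^sup>+\<omega>. ennreal (exp (v \<bullet> z \<omega> + (\<Sum>e\<in>B. (e \<bullet> z \<omega>)\<^sup>2) / (4 * \<sigma>\<^sup>2))) \<partial>M)
    = ennreal (sqrt 2 ^ card B * exp (\<sigma>\<^sup>2 * (norm v)\<^sup>2 / 2 + \<sigma>\<^sup>2 * (\<Sum>e\<in>B. (e \<bullet> v)\<^sup>2) / 2))"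
  using B
proof (induction B arbitrary: v)
  case empty
  then show ?case using isotropic_gaussian_mgf[OF z s] by simp
next
  case (insert e B)
  interpret prob_space M by (rule M)
  interpret pair_sigma_finite M lborel ..
  have [measurable]: "z \<in> borel_measurable M"
    using z by (rule isotropic_gaussian_measurable)
  define Q where "Q x = (\<Sum>e\<in>B. (e \<bullet> x)\<^sup>2)" for x
  \<comment> \<open>With the scale \<open>sqrt 2 * \<sigma>\<close>, averaging
    \<open>exp (w g \<bullet> z \<omega>)\<close> over a standard normal \<open>g\<close> multiplies
    \<open>exp (v \<bullet> z \<omega>)\<close> by exactly the new factor \<open>exp ((e \<bullet> z
    \<omega>)\<^sup>2 / (4 * \<sigma>\<^sup>2))\<close>.\<close>
  define w where "w g = v + (g / (sqrt 2 * \<sigma>)) *\<^sub>R e" for g :: real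
  have IH: "(\<integral>\<^sup>+\<omega>. ennreal (exp (u \<bullet> z \<omega> + Q (z \<omega>) / (4 * \<sigma>\<^sup>2))) \<partial>M)
     = ennreal (sqrt 2 ^ card B * exp (\<sigma>\<^sup>2 * (norm u)\<^sup>2 / 2 + \<sigma>\<^sup>2 * Q u / 2))" for u
    using insert unfolding Q_def by (simp add: pairwise_insert)
  have e: "e \<bullet> e = 1" using insert.prems by (simp add: norm_eq_1)
  have orth: "b \<bullet> e = 0" if "b \<in> B" for b
    using insert.prems(1) insert.hyps that by (auto simp: pairwise_insert orthogonal_def)
  \<comment> \<open>Orthogonality of \<open>e\<close> to \<open>B\<close> keeps the old squares free
    of \<open>g\<close>, so only the norm of \<open>w g\<close> matters in the integral over
    \<open>g\<close>.\<close>
  have Qw: "Q (w g) = Q v" for g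
    by (simp add: Q_def w_def inner_add_right orth)
  have nw: "\<sigma>\<^sup>2 * (norm (w g))\<^sup>2 / 2 = \<sigma>\<^sup>2 * (norm v)\<^sup>2 / 2 + (\<sigma> * (e \<bullet> v) / sqrt 2 * g + g\<^sup>2 / 4)" for g
  proof -
    have "(norm (w g))\<^sup>2 = (norm v)\<^sup>2 + 2 * (g / (sqrt 2 * \<sigma>)) * (e \<bullet> v) + (g / (sqrt 2 * \<sigma>))\<^sup>2"
      unfolding power2_norm_eq_inner
      by (simp add: w_def inner_add_left inner_add_right e inner_commute[of v e] power2_eq_square distrib_left
          mult.commute[of \<sigma>])
    then have "\<sigma>\<^sup>2 * (norm (w g))\<^sup>2 / 2 = \<sigma>\<^sup>2 * (norm v)\<^sup>2 / 2
       + \<sigma>\<^sup>2 * (g / (sqrt 2 * \<sigma>)) * (e \<bullet> v) + \<sigma>\<^sup>2 * (g / (sqrt 2 * \<sigma>))\<^sup>2 / 2"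
      by (simp add: algebra_simps add_divide_distrib)
    also have "\<sigma>\<^sup>2 * (g / (sqrt 2 * \<sigma>)) * (e \<bullet> v) = \<sigma> * (e \<bullet> v) / sqrt 2 * g"
      using s by (simp add: power2_eq_square)
    also have "\<sigma>\<^sup>2 * (g / (sqrt 2 * \<sigma>))\<^sup>2 / 2 = g\<^sup>2 / 4"
      using s by (simp add: power_divide power_mult_distrib)
    finally show ?thesis by simp
  qed
  have lin: "ennreal (exp (v \<bullet> z \<omega> + (\<Sum>e\<in>insert e B. (e \<bullet> z \<omega>)\<^sup>2) / (4 * \<sigma>\<^sup>2)))
     = (\<integral>\<^sup>+g. ennreal (normal_density 0 1 g * exp (w g \<bullet> z \<omega> + Q (z \<omega>) / (4 * \<sigma>\<^sup>2))) \<partial>lborel)" for \<omega>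
  proof -
    define x where "x = (e \<bullet> z \<omega>) / (sqrt 2 * \<sigma>)"
    define r where "r = exp (v \<bullet> z \<omega> + Q (z \<omega>) / (4 * \<sigma>\<^sup>2))"
    have "(\<integral>\<^sup>+g. ennreal (normal_density 0 1 g * exp (w g \<bullet> z \<omega> + Q (z \<omega>) / (4 * \<sigma>\<^sup>2))) \<partial>lborel)
       = (\<integral>\<^sup>+g. ennreal r * ennreal (normal_density 0 1 g * exp (x * g)) \<partial>lborel)"
      by (intro nn_integral_cong)
        (simp add: r_def w_def x_def inner_add_left exp_add normal_density_nonneg mult_ac flip: ennreal_mult)
    also have "\<dots> = ennreal r * ennreal (exp (x\<^sup>2 / 2))"
      by (subst nn_integral_cmult) (simp_all add: nn_integral_normal_density_exp)
    also have "\<dots> = ennreal (exp (v \<bullet> z \<omega> + Q (z \<omega>) / (4 * \<sigma>\<^sup>2) + x\<^sup>2 / 2))"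
      by (simp add: r_def exp_add flip: ennreal_mult)
    also have "v \<bullet> z \<omega> + Q (z \<omega>) / (4 * \<sigma>\<^sup>2) + x\<^sup>2 / 2
       = v \<bullet> z \<omega> + (\<Sum>e\<in>insert e B. (e \<bullet> z \<omega>)\<^sup>2) / (4 * \<sigma>\<^sup>2)"
      using insert.hyps by (simp add: x_def Q_def power_divide power_mult_distrib add_divide_distrib)
    finally show ?thesis by simp
  qed
  have "(\<integral>\<^sup>+\<omega>. ennreal (exp (v \<bullet> z \<omega> + (\<Sum>e\<in>insert e B. (e \<bullet> z \<omega>)\<^sup>2) / (4 * \<sigma>\<^sup>2))) \<partial>M)
     = (\<integral>\<^sup>+\<omega>. \<integral>\<^sup>+g. ennreal (normal_density 0 1 g * exp (w g \<bullet> z \<omega> + Q (z \<omega>) / (4 * \<sigma>\<^sup>2))) \<partial>lborel \<partial>M)"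
    by (simp only: lin)
  \<comment> \<open>After the exchange of integrals \<open>g\<close> is fixed, and the induction
    hypothesis applies with linear term \<open>w g\<close>.\<close>
  also have "\<dots> = (\<integral>\<^sup>+g. \<integral>\<^sup>+\<omega>. ennreal (normal_density 0 1 g * exp (w g \<bullet> z \<omega> + Q (z \<omega>) / (4 * \<sigma>\<^sup>2))) \<partial>M \<partial>lborel)"
    by (rule Fubini'[symmetric]) (simp add: w_def Q_def)
  also have "\<dots> = (\<integral>\<^sup>+g. ennreal (sqrt 2 ^ card B * exp (\<sigma>\<^sup>2 * (norm v)\<^sup>2 / 2 + \<sigma>\<^sup>2 * Q v / 2))
      * ennreal (normal_density 0 1 g * exp (\<sigma> * (e \<bullet> v) / sqrt 2 * g + g\<^sup>2 / 4)) \<partial>lborel)"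
  proof (rule nn_integral_cong)
    fix g :: real
    have [measurable]: "(\<lambda>\<omega>. exp (w g \<bullet> z \<omega> + Q (z \<omega>) / (4 * \<sigma>\<^sup>2))) \<in> borel_measurable M"
      by (simp add: w_def Q_def)
    have "(\<integral>\<^sup>+\<omega>. ennreal (normal_density 0 1 g * exp (w g \<bullet> z \<omega> + Q (z \<omega>) / (4 * \<sigma>\<^sup>2))) \<partial>M)
      = ennreal (normal_density 0 1 g) * (\<integral>\<^sup>+\<omega>. ennreal (exp (w g \<bullet> z \<omega> + Q (z \<omega>) / (4 * \<sigma>\<^sup>2))) \<partial>M)"
      by (simp add: ennreal_mult normal_density_nonneg nn_integral_cmult)
    also have "\<dots> = ennreal (normal_density 0 1 g *
       (sqrt 2 ^ card B * exp (\<sigma>\<^sup>2 * (norm (w g))\<^sup>2 / 2 + \<sigma>\<^sup>2 * Q v / 2)))"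
      by (simp add: IH Qw ennreal_mult' normal_density_nonneg)
    also have "normal_density 0 1 g *
       (sqrt 2 ^ card B * exp (\<sigma>\<^sup>2 * (norm (w g))\<^sup>2 / 2 + \<sigma>\<^sup>2 * Q v / 2))
       = (sqrt 2 ^ card B * exp (\<sigma>\<^sup>2 * (norm v)\<^sup>2 / 2 + \<sigma>\<^sup>2 * Q v / 2))
         * (normal_density 0 1 g * exp (\<sigma> * (e \<bullet> v) / sqrt 2 * g + g\<^sup>2 / 4))"
      unfolding nw by (simp only: exp_add mult_ac)
    finally show "(\<integral>\<^sup>+\<omega>. ennreal (normal_density 0 1 g * exp (w g \<bullet> z \<omega> + Q (z \<omega>) / (4 * \<sigma>\<^sup>2))) \<partial>M)
      = ennreal (sqrt 2 ^ card B * exp (\<sigma>\<^sup>2 * (norm v)\<^sup>2 / 2 + \<sigma>\<^sup>2 * Q v / 2))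
      * ennreal (normal_density 0 1 g * exp (\<sigma> * (e \<bullet> v) / sqrt 2 * g + g\<^sup>2 / 4))"
      by (simp add: ennreal_mult normal_density_nonneg)
  qed
  \<comment> \<open>The integral over \<open>g\<close> supplies one more \<open>sqrt 2\<close> and
    the contribution of \<open>e\<close> to the exponent.\<close>
  also have "\<dots> = ennreal (sqrt 2 ^ card B * exp (\<sigma>\<^sup>2 * (norm v)\<^sup>2 / 2 + \<sigma>\<^sup>2 * Q v / 2))
      * ennreal (sqrt 2 * exp ((\<sigma> * (e \<bullet> v) / sqrt 2)\<^sup>2))"
    by (subst nn_integral_cmult; (simp only: nn_integral_std_normal_exp_square | simp))
  also have "\<dots> = ennreal (sqrt 2 ^ card B * exp (\<sigma>\<^sup>2 * (norm v)\<^sup>2 / 2 + \<sigma>\<^sup>2 * Q v / 2)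
      * (sqrt 2 * exp ((\<sigma> * (e \<bullet> v) / sqrt 2)\<^sup>2)))"
    by (simp add: ennreal_mult)
  also have "sqrt 2 ^ card B * exp (\<sigma>\<^sup>2 * (norm v)\<^sup>2 / 2 + \<sigma>\<^sup>2 * Q v / 2)
      * (sqrt 2 * exp ((\<sigma> * (e \<bullet> v) / sqrt 2)\<^sup>2))
    = sqrt 2 ^ card (insert e B) * exp (\<sigma>\<^sup>2 * (norm v)\<^sup>2 / 2 + \<sigma>\<^sup>2 * Q v / 2 + (\<sigma> * (e \<bullet> v) / sqrt 2)\<^sup>2)"
    using insert.hyps by (simp add: exp_add)
  also have "\<sigma>\<^sup>2 * (norm v)\<^sup>2 / 2 + \<sigma>\<^sup>2 * Q v / 2 + (\<sigma> * (e \<bullet> v) / sqrt 2)\<^sup>2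
    = \<sigma>\<^sup>2 * (norm v)\<^sup>2 / 2 + \<sigma>\<^sup>2 * (\<Sum>e\<in>insert e B. (e \<bullet> v)\<^sup>2) / 2"
    using insert.hyps by (simp add: Q_def power_divide power_mult_distrib distrib_left add_divide_distrib)
  finally show ?case .
qed

section \<open>Chernoff bounds\<close>

lemma prob_exp_markov:
  assumes M: "prob_space M" and f[measurable]: "f \<in> borel_measurable M"
    and le: "(\<integral>\<^sup>+\<omega>. ennreal (exp (f \<omega>)) \<partial>M) \<le> ennreal C" and C: "0 \<le> C"
  shows "measure M {\<omega> \<in> space M. f \<omega> > a} \<le> exp (- a) * C"
proof -
  interpret prob_space M by (rule M)
  have "emeasure M {\<omega> \<in> space M. f \<omega> > a}
      \<le> emeasure M {\<omega> \<in> space M. 1 \<le> ennreal (exp (- a)) * ennreal (exp (f \<omega>))}"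
  proof (rule emeasure_mono)
    have "1 \<le> ennreal (exp (- a)) * ennreal (exp (f \<omega>))" if "f \<omega> > a" for \<omega>
    proof -
      have "1 \<le> exp (- a) * exp (f \<omega>)" using that by (simp flip: exp_add)
      then show ?thesis by (simp flip: ennreal_mult)
    qed
    then show "{\<omega> \<in> space M. f \<omega> > a} \<subseteq> {\<omega> \<in> space M. 1 \<le> ennreal (exp (- a)) * ennreal (exp (f \<omega>))}"
      by auto
  qed simp
  also have "\<dots> \<le> ennreal (exp (- a)) * (\<integral>\<^sup>+\<omega>. ennreal (exp (f \<omega>)) * indicator (space M) \<omega> \<partial>M)"
    using nn_integral_Markov_inequality[of "\<lambda>\<omega>. ennreal (exp (f \<omega>))" "space M" M "ennreal (exp (- a))"]
    by simp
  also have "\<dots> = ennreal (exp (- a)) * (\<integral>\<^sup>+\<omega>. ennreal (exp (f \<omega>)) \<partial>M)"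
    by (simp cong: nn_integral_cong)
  also have "\<dots> \<le> ennreal (exp (- a)) * ennreal C"
    by (intro mult_left_mono le) simp
  also have "\<dots> = ennreal (exp (- a) * C)"
    using C by (simp add: ennreal_mult)
  finally show ?thesis
    using C by (simp add: emeasure_eq_measure ennreal_le_iff)
qed

lemma gaussian_linear_upper_tail:
  assumes M: "prob_space M" and z: "isotropic_gaussian M \<sigma> z" and s: "\<sigma> > 0" and t: "t > 0"
  shows "measure M {\<omega> \<in> space M. v \<bullet> z \<omega> > \<sigma> * norm v * t} \<le> exp (- t\<^sup>2 / 2)"
proof (cases "v = 0")
  case False
  \<comment> \<open>This scaling minimises the Chernoff bound: \<open>\<sigma> * norm u = t\<close>,
    so the exponent is \<open>t\<^sup>2 / 2 - t\<^sup>2\<close>.\<close>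
  define u where "u = (t / (\<sigma> * norm v)) *\<^sub>R v"
  have [measurable]: "z \<in> borel_measurable M" using z by (rule isotropic_gaussian_measurable)
  have nv: "\<sigma> * norm u = t" using s t False by (simp add: u_def)
  have "(\<integral>\<^sup>+\<omega>. ennreal (exp (u \<bullet> z \<omega>)) \<partial>M) = ennreal (exp (t\<^sup>2 / 2))"
    by (simp add: isotropic_gaussian_mgf[OF z s] flip: nv power_mult_distrib)
  then have "measure M {\<omega> \<in> space M. u \<bullet> z \<omega> > t\<^sup>2} \<le> exp (- t\<^sup>2) * exp (t\<^sup>2 / 2)"
    by (intro prob_exp_markov M) auto
  also have "\<dots> = exp (- t\<^sup>2 / 2)"
    by (simp flip: exp_add)
  also have "{\<omega> \<in> space M. u \<bullet> z \<omega> > t\<^sup>2} = {\<omega> \<in> space M. v \<bullet> z \<omega> > \<sigma> * norm v * t}"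
    using s t False by (simp add: u_def field_simps power2_eq_square)
  finally show ?thesis .
qed simp

lemma gaussian_linear_tail:
  assumes M: "prob_space M" and z: "isotropic_gaussian M \<sigma> z" and s: "\<sigma> > 0" and L: "L > 0"
  shows "measure M {\<omega> \<in> space M. \<bar>v \<bullet> z \<omega>\<bar> > \<sigma> * norm v * sqrt (2 * L)} \<le> 2 * exp (- L)"
proof -
  interpret prob_space M by (rule M)
  define A where "A v = {\<omega> \<in> space M. v \<bullet> z \<omega> > \<sigma> * norm v * sqrt (2 * L)}" for v
  have [measurable]: "z \<in> borel_measurable M" using z by (rule isotropic_gaussian_measurable)
  have [measurable]: "A v \<in> sets M" for v unfolding A_def by measurable
  have A: "prob (A v) \<le> exp (- L)" for v
    using gaussian_linear_upper_tail[OF M z s, of "sqrt (2 * L)" v] L by (simp add: A_def)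
  have "{\<omega> \<in> space M. \<bar>v \<bullet> z \<omega>\<bar> > \<sigma> * norm v * sqrt (2 * L)} = A v \<union> A (- v)"
    by (auto simp: A_def abs_if split: if_splits)
  also have "prob \<dots> \<le> prob (A v) + prob (A (- v))"
    by (rule measure_Un_le) auto
  finally show ?thesis
    using A[of v] A[of "- v"] by linarith
qed

text \<open>The exponential moment is taken at \<open>1 / (4 * \<sigma>\<^sup>2)\<close>, half the
  critical rate, where each degree of freedom costs a factor \<open>sqrt 2\<close>.\<close>

lemma gaussian_squares_tail:
  fixes z :: "'a \<Rightarrow> real ^ 'n"
  assumes M: "prob_space M" and z: "isotropic_gaussian M \<sigma> z" and s: "\<sigma> > 0"
    and B: "finite B" "pairwise orthogonal B" "\<And>e. e \<in> B \<Longrightarrow> norm e = 1" "card B \<le> t"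
  shows "measure M {\<omega> \<in> space M. (\<Sum>e\<in>B. (e \<bullet> z \<omega>)\<^sup>2) > 4 * \<sigma>\<^sup>2 * L} \<le> exp (- L) * sqrt 2 ^ t"
proof -
  have [measurable]: "z \<in> borel_measurable M" using z by (rule isotropic_gaussian_measurable)
  have "(\<integral>\<^sup>+\<omega>. ennreal (exp ((\<Sum>e\<in>B. (e \<bullet> z \<omega>)\<^sup>2) / (4 * \<sigma>\<^sup>2))) \<partial>M) = ennreal (sqrt 2 ^ card B)"
    using isotropic_gaussian_mgf_squares[OF M z s B(1,2,3), of 0] by simp
  also have "\<dots> \<le> ennreal (sqrt 2 ^ t)"
    using B(4) by (intro ennreal_leI power_increasing) auto
  finally have "measure M {\<omega> \<in> space M. (\<Sum>e\<in>B. (e \<bullet> z \<omega>)\<^sup>2) / (4 * \<sigma>\<^sup>2) > L} \<le> exp (- L) * sqrt 2 ^ t"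
    by (intro prob_exp_markov M) auto
  also have "{\<omega> \<in> space M. (\<Sum>e\<in>B. (e \<bullet> z \<omega>)\<^sup>2) / (4 * \<sigma>\<^sup>2) > L}
      = {\<omega> \<in> space M. (\<Sum>e\<in>B. (e \<bullet> z \<omega>)\<^sup>2) > 4 * \<sigma>\<^sup>2 * L}"
    using s by (simp add: field_simps)
  finally show ?thesis .
qed

section \<open>Union bounds and binomial coefficients\<close>

lemma measure_UN_le_sum:
  assumes "finite I" "\<And>i. i \<in> I \<Longrightarrow> F i \<in> sets M" "\<And>i. i \<in> I \<Longrightarrow> measure M (F i) \<le> b i"
  shows "measure M (\<Union>i\<in>I. F i) \<le> sum b I"
  using order_trans[OF measure_UNION_le[of I F M] sum_mono[of I "\<lambda>i. measure M (F i)" b]] assms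
  by blast

text \<open>With \<open>p\<close> the number of indices, the subsets of size \<open>d\<close>
  contribute at most \<open>(p * q) ^ d\<close>, hence at most \<open>p * q\<close>, and there are
  \<open>p\<close> possible sizes.\<close>

lemma sum_nonempty_subsets_power_le:
  fixes q :: real
  assumes q: "0 \<le> q" "real CARD('p) * q \<le> 1"
  shows "(\<Sum>T | T \<noteq> ({} :: 'p::finite set). q ^ card T) \<le> (real CARD('p))\<^sup>2 * q"
proof -
  let ?p = "CARD('p)"
  have "card ` {T. T \<noteq> ({} :: 'p set)} \<subseteq> {1..?p}"
    by (auto simp: card_mono Suc_le_eq card_gt_0_iff)
  then have "(\<Sum>T | T \<noteq> ({} :: 'p set). q ^ card T)
     = (\<Sum>d\<in>{1..?p}. \<Sum>T\<in>{T \<in> {T. T \<noteq> {}}. card T = d}. q ^ card (T :: 'p set))"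
    by (intro sum.group[symmetric]) auto
  also have "\<dots> \<le> (\<Sum>d\<in>{1..?p}. real ?p * q)"
  proof (rule sum_mono)
    fix d assume d: "d \<in> {1..?p}"
    then have "{T \<in> {T. T \<noteq> {}}. card (T :: 'p set) = d} = {T. T \<subseteq> UNIV \<and> card T = d}"
      by auto
    then have "(\<Sum>T\<in>{T \<in> {T. T \<noteq> {}}. card T = d}. q ^ card (T :: 'p set)) = real (?p choose d) * q ^ d"
      by (simp add: n_subsets[of UNIV, simplified])
    also have "\<dots> \<le> real (?p ^ d) * q ^ d"
      using d q by (intro mult_right_mono of_nat_mono binomial_le_pow) auto
    also have "\<dots> = (real ?p * q) ^ d" by (simp add: power_mult_distrib)
    also have "\<dots> \<le> (real ?p * q) ^ 1"
      using d q by (intro power_decreasing) auto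
    finally show "(\<Sum>T\<in>{T \<in> {T. T \<noteq> {}}. card T = d}. q ^ card (T :: 'p set)) \<le> real ?p * q" by simp
  qed
  also have "\<dots> = (real ?p)\<^sup>2 * q" by (simp add: power2_eq_square)
  finally show ?thesis .
qed

text \<open>Under truncated subtraction the exponent is the distance between \<open>m\<close> and
  \<open>s\<close>. Counting nested pairs of an \<open>m\<close>-set and an \<open>s\<close>-set in
  two ways compares the two coefficients, and the binomial left over is at most a power of
  \<open>p\<close>.\<close>

lemma binomial_le_binomial_mult_power:
  assumes "m \<le> p" "s \<le> p"
  shows "p choose m \<le> (p choose s) * p ^ ((s - m) + (m - s))"
proof (cases "m \<le> s")
  case True
  have "0 < (p - m) choose (s - m)"
    using assms by (intro zero_less_binomial diff_le_mono)
  then have "(p choose m) * 1 \<le> (p choose m) * ((p - m) choose (s - m))"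
    by (intro mult_le_mono2) linarith
  also have "(p choose m) * ((p - m) choose (s - m)) = (p choose s) * (s choose (s - m))"
    using choose_mult[OF True assms(2)] binomial_symmetric[OF True] by simp
  also have "\<dots> \<le> (p choose s) * p ^ (s - m)"
    using assms True by (intro mult_le_mono2 order_trans[OF binomial_le_pow power_mono]) auto
  finally show ?thesis using True by simp
next
  case False
  then have sm: "s \<le> m" by simp
  have "0 < m choose s"
    by (intro zero_less_binomial sm)
  then have "(p choose m) * 1 \<le> (p choose m) * (m choose s)"
    by (intro mult_le_mono2) linarith
  also have "(p choose m) * (m choose s) = (p choose s) * ((p - s) choose (m - s))"
    by (rule choose_mult[OF sm assms(1)])
  also have "\<dots> \<le> (p choose s) * p ^ (m - s)"
    using assms sm by (intro mult_le_mono2 order_trans[OF binomial_le_pow power_mono]) auto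
  finally show ?thesis using sm by simp
qed

subsection \<open>Comparison of posterior weights\<close>

text \<open>The projection is \<open>X *v a\<close> with \<open>a\<close> supported in
  \<open>J\<close>, so the residual is \<open>X *v (b - a)\<close>, and the restricted eigenvalue
  applies on \<open>J \<union> vec_supp b\<close>. On the indices missing from \<open>J\<close> the
  vector \<open>a\<close> vanishes, so \<open>b - a\<close> keeps the entries of
  \<open>b\<close>.\<close>

lemma signal_residual_ge:
  fixes X :: "real ^ 'p ^ 'n"
  assumes J: "real (card (J \<union> vec_supp b)) \<le> s" and nu: "nu X s > 0"
    and \<tau>: "0 \<le> \<tau>" "\<And>j. j \<in> vec_supp b \<Longrightarrow> \<tau> \<le> \<bar>b $ j\<bar>"
  shows "(nu X s)\<^sup>2 * real CARD('n) * (real (card (vec_supp b - J)) * \<tau>\<^sup>2)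
         \<le> (norm (X *v b - proj_cols X J (X *v b)))\<^sup>2"
proof -
  obtain a where a: "vec_supp a \<subseteq> J" "proj_cols X J (X *v b) = X *v a"
    using proj_cols_in[of X J "X *v b"] unfolding col_space_eq by auto
  have "nu X s * sqrt (real CARD('n)) * norm (b - a) \<le> norm (X *v (b - a))"
    using a(1) by (intro nu_le[OF _ J]) (auto simp: vec_supp_def)
  then have "(nu X s * sqrt (real CARD('n)) * norm (b - a))\<^sup>2 \<le> (norm (X *v (b - a)))\<^sup>2"
    using nu by (intro power_mono) auto
  moreover have "real (card (vec_supp b - J)) * \<tau>\<^sup>2 \<le> (norm (b - a))\<^sup>2"
  proof -
    have "real (card (vec_supp b - J)) * \<tau>\<^sup>2 = (\<Sum>j\<in>vec_supp b - J. \<tau>\<^sup>2)" by simp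
    also have "\<dots> \<le> (\<Sum>j\<in>vec_supp b - J. ((b - a) $ j)\<^sup>2)"
    proof (rule sum_mono)
      fix j assume j: "j \<in> vec_supp b - J"
      then have "a $ j = 0" using a(1) by (auto simp: vec_supp_def)
      moreover have "\<tau>\<^sup>2 \<le> \<bar>b $ j\<bar>\<^sup>2"
        using \<tau> j by (intro power_mono) auto
      ultimately show "\<tau>\<^sup>2 \<le> ((b - a) $ j)\<^sup>2" by simp
    qed
    also have "\<dots> \<le> (\<Sum>j\<in>UNIV. ((b - a) $ j)\<^sup>2)"
      by (intro sum_mono2) auto
    also have "\<dots> = (norm (b - a))\<^sup>2"
      by (simp only: power2_norm_eq_inner inner_vec_def) (simp add: power2_eq_square)
    finally show ?thesis .
  qed
  then have "(nu X s)\<^sup>2 * real CARD('n) * (real (card (vec_supp b - J)) * \<tau>\<^sup>2)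
      \<le> (nu X s)\<^sup>2 * real CARD('n) * (norm (b - a))\<^sup>2"
    by (intro mult_left_mono) auto
  ultimately show ?thesis
    by (simp add: a(2) power_mult_distrib matrix_vector_mult_diff_distrib)
qed

text \<open>In the logarithm of the ratio of weights the normalising constants cancel, and the ratio
  of binomials costs at most \<open>h * ln p\<close>. Beyond the size bound \<open>sbar\<close> the
  weight of \<open>J\<close> is zero, hence the guard on the inequality.\<close>

lemma posterior_less:
  fixes X :: "real ^ 'p ^ 'n" and y :: "real ^ 'n" and J K :: "'p set"
  defines "R \<equiv> \<lambda>J. (norm (y - proj_cols X J y))\<^sup>2"
  assumes K: "card K \<le> sbar"
    and h: "(card J - card K) + (card K - card J) \<le> h"
    and less: "card J \<le> sbar \<Longrightarrow> real h * ln (real CARD('p))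
       < lam * (real (card J) - real (card K)) + (R J - R K) / (2 * \<sigma>\<^sup>2)"
  shows "posterior X \<sigma> sbar lam y J < posterior X \<sigma> sbar lam y K"
proof -
  let ?p = "CARD('p)"
  have cardp: "card I \<le> ?p" for I :: "'p set" by (simp add: card_mono)
  have nonneg: "0 \<le> prior_weight sbar lam I" for I :: "'p set"
    by (simp add: prior_weight_def)
  have pos: "0 < prior_weight sbar lam K"
    using K cardp[of K] by (simp add: prior_weight_def zero_less_binomial_iff)
  have Z: "0 < (\<Sum>I\<in>UNIV. prior_weight sbar lam (I :: 'p set))"
    using nonneg pos by (intro sum_pos2[of _ K]) auto
  have wnonneg: "0 \<le> posterior_weight X \<sigma> sbar lam y I" for I
    using nonneg Z by (simp add: posterior_weight_def prior_def)
  have wpos: "0 < posterior_weight X \<sigma> sbar lam y K"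
    using pos Z by (simp add: posterior_weight_def prior_def)
  have Z': "0 < (\<Sum>I\<in>UNIV. posterior_weight X \<sigma> sbar lam y I)"
    using wnonneg wpos by (intro sum_pos2[of _ K]) auto
  have "prior_weight sbar lam J * exp (- R J / (2 * \<sigma>\<^sup>2)) < prior_weight sbar lam K * exp (- R K / (2 * \<sigma>\<^sup>2))"
  proof (cases "card J \<le> sbar")
    case True
    define CJ CK where "CJ = real (?p choose card J)" and "CK = real (?p choose card K)"
    have C: "CJ > 0" "CK > 0"
      using cardp by (simp_all add: CJ_def CK_def zero_less_binomial_iff)
    have "?p ^ ((card J - card K) + (card K - card J)) \<le> ?p ^ h"
      using h by (rule power_increasing) (simp add: Suc_le_eq)
    then have "?p choose card K \<le> (?p choose card J) * ?p ^ h"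
      by (rule order_trans[OF binomial_le_binomial_mult_power[OF cardp cardp] mult_le_mono2])
    then have "CK \<le> CJ * real ?p ^ h"
      unfolding CJ_def CK_def by (metis of_nat_le_iff of_nat_mult of_nat_power)
    also have "real ?p ^ h = exp (real h * ln (real ?p))"
      by (simp add: exp_of_nat_mult)
    also have "CJ * \<dots> < CJ * exp (lam * (real (card J) - real (card K)) + (R J - R K) / (2 * \<sigma>\<^sup>2))"
      using less[OF True] C by simp
    finally have "CK * exp (- lam * real (card J) - R J / (2 * \<sigma>\<^sup>2))
      < CJ * exp (lam * (real (card J) - real (card K)) + (R J - R K) / (2 * \<sigma>\<^sup>2))
           * exp (- lam * real (card J) - R J / (2 * \<sigma>\<^sup>2))"
      by simp
    also have "\<dots> = CJ * exp (- lam * real (card K) - R K / (2 * \<sigma>\<^sup>2))"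
      unfolding mult.assoc exp_add[symmetric] by (simp add: algebra_simps diff_divide_distrib)
    finally have "exp (- lam * real (card J) - R J / (2 * \<sigma>\<^sup>2)) / CJ < exp (- lam * real (card K) - R K / (2 * \<sigma>\<^sup>2)) / CK"
      using C by (simp add: field_simps)
    then show ?thesis
      using True K by (simp add: prior_weight_def CJ_def CK_def exp_diff exp_minus field_simps)
  next
    case False
    then have "prior_weight sbar lam J = 0" by (simp add: prior_weight_def)
    then show ?thesis using pos by simp
  qed
  then have "posterior_weight X \<sigma> sbar lam y J < posterior_weight X \<sigma> sbar lam y K"
    using Z by (simp add: posterior_weight_def prior_def R_def divide_strict_right_mono)
  then show ?thesis
    using Z' by (simp add: posterior_def divide_strict_right_mono)
qed

text \<open>Adding \<open>J0\<close> to \<open>J\<close> can only lower the residual, and over any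
  set containing \<open>J0\<close> the mean \<open>\<mu>\<close> disappears from it, leaving pure
  noise. The first bound does this for \<open>\<mu> + x\<close>; the second splits off
  \<open>v\<close> first and does it for \<open>x\<close> alone.\<close>

lemma residual_difference_ge:
  assumes \<mu>: "\<mu> \<in> col_space X J0"
    and W: "\<And>x. (norm (x - proj_cols X J0 x))\<^sup>2 = (norm (x - proj_cols X (J0 \<union> (J - J0)) x))\<^sup>2 + W x"
  defines "R \<equiv> \<lambda>J y. (norm (y - proj_cols X J y))\<^sup>2"
    and "v \<equiv> \<mu> - proj_cols X J \<mu>"
  shows "R J (\<mu> + x) - R J0 (\<mu> + x) \<ge> - W x"
    and "R J (\<mu> + x) - R J0 (\<mu> + x) \<ge> (norm v)\<^sup>2 + 2 * (v \<bullet> x) - W x"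
proof -
  have un: "J0 \<union> (J - J0) = J0 \<union> J" by blast
  have shift: "R I (\<mu> + x) = R I x" if "J0 \<subseteq> I" for I
  proof -
    have "\<mu> \<in> col_space X I" using \<mu> span_mono[OF image_mono[OF that]] by blast
    then show ?thesis by (simp add: R_def proj_cols_add proj_cols_self)
  qed
  have W': "R J0 x = R (J0 \<union> J) x + W x"
    unfolding R_def using W[of x] by (simp add: un)
  have anti: "R (J0 \<union> J) y \<le> R J y" for y
    unfolding R_def by (intro residual_antimono) auto
  show "R J (\<mu> + x) - R J0 (\<mu> + x) \<ge> - W x"
    using anti[of "\<mu> + x"] W' by (simp add: shift)
  have "R J (\<mu> + x) = (norm (v + (x - proj_cols X J x)))\<^sup>2"
    by (simp add: R_def v_def proj_cols_add algebra_simps)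
  also have "\<dots> = (norm v)\<^sup>2 + 2 * (v \<bullet> (x - proj_cols X J x)) + R J x"
    by (simp add: R_def power2_norm_eq_inner inner_add_left inner_add_right inner_commute)
  \<comment> \<open>\<open>v\<close> is orthogonal to the column span of \<open>J\<close>.\<close>
  also have "v \<bullet> (x - proj_cols X J x) = v \<bullet> x"
    by (simp add: inner_diff_right v_def inner_proj_cols_residual proj_cols_in)
  finally show "R J (\<mu> + x) - R J0 (\<mu> + x) \<ge> (norm v)\<^sup>2 + 2 * (v \<bullet> x) - W x"
    using anti[of x] W' by (simp add: shift)
qed

section \<open>Numerical inequalities for the two regimes\<close>

text \<open>Here \<open>s\<close> and \<open>s0\<close> are the sizes of the competitor and of the
  true support, \<open>t\<close> counts false indices and \<open>l\<close> is \<open>ln p\<close>.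
  Since \<open>s - s0\<close> exceeds the fraction \<open>\<epsilon> / (1 + \<epsilon>)\<close> of
  \<open>s\<close>, the choice of \<open>lam\<close> yields a penalty of at least
  \<open>(23 + 5 * c) * s * l\<close>, against at most \<open>(2 * c + 5) * s * l\<close> of noise
  and \<open>s * l\<close> from the prior.\<close>

lemma posterior_gap_overfit:
  fixes s s0 t l c \<epsilon> \<sigma> lam W D :: real
  assumes "\<sigma> > 0" "l > 0" "\<epsilon> > 0" "c \<ge> 1" "s > (1 + \<epsilon>) * s0" "s > 0" "0 \<le> t" "t \<le> s"
    and lam: "lam = (1 + \<epsilon>) / \<epsilon> * (23 + 5 * c) * l"
    and W: "W \<le> 4 * \<sigma>\<^sup>2 * ((c + 5 / 2) * t * l)" and D: "D \<ge> - W"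
  shows "s * l < lam * (s - s0) + D / (2 * \<sigma>\<^sup>2)"
proof -
  have "s \<le> (1 + \<epsilon>) / \<epsilon> * (s - s0)"
    using assms by (simp add: field_simps)
  then have "(23 + 5 * c) * l * s \<le> (23 + 5 * c) * l * ((1 + \<epsilon>) / \<epsilon> * (s - s0))"
    using assms by (intro mult_left_mono) auto
  then have 1: "(23 + 5 * c) * l * s \<le> lam * (s - s0)"
    by (simp add: lam mult_ac)
  have "- (2 * ((c + 5 / 2) * t * l)) \<le> D / (2 * \<sigma>\<^sup>2)"
    using W D \<open>\<sigma> > 0\<close> by (simp add: field_simps)
  moreover have "(c + 5 / 2) * t * l \<le> (c + 5 / 2) * s * l"
    using assms by (intro mult_right_mono mult_left_mono) auto
  moreover have "0 < s * l" "0 \<le> c * (s * l)" using assms by auto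
  ultimately show ?thesis using 1 by (simp add: algebra_simps)
qed

text \<open>\<open>k\<close> counts missing indices and \<open>m\<close> is the norm of the
  unexplained signal. Half of \<open>m\<^sup>2\<close> absorbs the cross term; the other half is
  worth \<open>9 / 4 * lam * k\<close>. So \<open>lam * t + 5 / 4 * lam * k\<close> is left to beat
  \<open>(4 * c + 10) * t * l + (2 * c + 5) * k * l\<close>.\<close>

lemma posterior_gap_near:
  fixes t k l c \<epsilon> \<sigma> lam W D m i :: real
  assumes "\<sigma> > 0" "l > 0" "\<epsilon> > 0" "c \<ge> 1" "0 \<le> t" "0 \<le> k" "0 < t + k"
    and lam: "lam = (1 + \<epsilon>) / \<epsilon> * (23 + 5 * c) * l"
    and W: "W \<le> 4 * \<sigma>\<^sup>2 * ((c + 5 / 2) * t * l)" and D: "D \<ge> m\<^sup>2 + 2 * i - W"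
    and m: "m\<^sup>2 \<ge> 9 * \<sigma>\<^sup>2 * lam * k"
    and i: "\<bar>i\<bar> \<le> \<sigma> * m * sqrt (2 * ((c + 2) * (t + k) * l))"
  shows "(t + k) * l < lam * (t - k) + D / (2 * \<sigma>\<^sup>2)"
proof -
  define a where "a = (c + 2) * (t + k) * l"
  have a0: "0 \<le> a" using assms by (simp add: a_def)
  have "1 \<le> (1 + \<epsilon>) / \<epsilon>" using assms by (simp add: field_simps)
  then have "1 * ((23 + 5 * c) * l) \<le> (1 + \<epsilon>) / \<epsilon> * ((23 + 5 * c) * l)"
    using assms by (intro mult_right_mono) auto
  then have lam_ge: "(23 + 5 * c) * l \<le> lam" by (simp add: lam mult_ac)
  \<comment> \<open>AM-GM, weighted so that the cross term uses up only half of
    \<open>m\<^sup>2\<close>.\<close>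
  have "0 \<le> (m - 2 * (\<sigma> * sqrt (2 * a)))\<^sup>2" by simp
  then have "4 * (\<sigma> * m * sqrt (2 * a)) \<le> m\<^sup>2 + 8 * \<sigma>\<^sup>2 * a"
    using a0 by (simp add: power2_diff power_mult_distrib mult_ac)
  then have "D \<ge> m\<^sup>2 / 2 - 4 * \<sigma>\<^sup>2 * a - W"
    using D i unfolding a_def by linarith
  then have "D \<ge> 9 / 2 * \<sigma>\<^sup>2 * lam * k - 4 * \<sigma>\<^sup>2 * a - 4 * \<sigma>\<^sup>2 * ((c + 5 / 2) * t * l)"
    using m W by linarith
  then have "D / (2 * \<sigma>\<^sup>2) \<ge> (9 / 2 * \<sigma>\<^sup>2 * lam * k - 4 * \<sigma>\<^sup>2 * a - 4 * \<sigma>\<^sup>2 * ((c + 5 / 2) * t * l)) / (2 * \<sigma>\<^sup>2)"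
    by (intro divide_right_mono) auto
  also have "(9 / 2 * \<sigma>\<^sup>2 * lam * k - 4 * \<sigma>\<^sup>2 * a - 4 * \<sigma>\<^sup>2 * ((c + 5 / 2) * t * l)) / (2 * \<sigma>\<^sup>2)
     = 9 / 4 * (lam * k) - 2 * a - 2 * ((c + 5 / 2) * t * l)"
    using \<open>\<sigma> > 0\<close> by (simp add: diff_divide_distrib mult_ac)
  finally have 1: "D / (2 * \<sigma>\<^sup>2) \<ge> 9 / 4 * (lam * k) - 2 * a - 2 * ((c + 5 / 2) * t * l)" .
  have "(23 + 5 * c) * l * t \<le> lam * t" "(23 + 5 * c) * l * k \<le> lam * k"
    using lam_ge \<open>0 \<le> t\<close> \<open>0 \<le> k\<close> by (simp_all add: mult_right_mono)
  moreover have "0 \<le> t * l" "0 \<le> k * l" "0 \<le> c * (t * l)" "0 \<le> c * (k * l)" "0 < t * l + k * l"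
    using assms by (auto simp flip: distrib_right)
  ultimately show ?thesis using 1 by (simp add: a_def algebra_simps)
qed

section \<open>Support recovery and the coordinatewise error\<close>

theorem theorem4:
  fixes M :: "'a measure"
    and X :: "real ^ 'p ^ 'n"
    and bstar :: "real ^ 'p"
    and z y :: "'a \<Rightarrow> real ^ 'n"
    and Jmap :: "'a \<Rightarrow> 'p set"
    and \<sigma> lam \<epsilon> c :: real
    and sbar sstar :: nat
  assumes prob: "prob_space M"
    and pn: "CARD('p) \<ge> CARD('n)"
    and cols: "\<And>j. norm (column j X) = sqrt (real CARD('n))"
    and sigma: "\<sigma> > 0"
    and noise: "isotropic_gaussian M \<sigma> z"
    and model: "\<And>\<omega>. \<omega> \<in> space M \<Longrightarrow> y \<omega> = X *v bstar + z \<omega>"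
    and sparsest: "sparsest_solution X (integral\<^sup>L M y) bstar"
    and sstar: "sstar = card (vec_supp bstar)"
    and sstar_bounds: "1 \<le> sstar" "sstar \<le> sbar"
    and sbar: "sbar \<le> CARD('p)"
    and eps: "\<epsilon> > 0"
    and c: "c \<ge> 1"
    and identifiable: "condition_I X ((2 + \<epsilon>) * real sstar)"
    and lam_pos: "lam > 0"
    and lam: "lam = (1 + \<epsilon>) / \<epsilon> * (23 + 5 * c) * ln (real CARD('p))"
    and beta_min: "(MIN j\<in>vec_supp bstar. \<bar>bstar $ j\<bar>)
                     \<ge> 3 * \<sigma> * sqrt (lam / real CARD('n)) / nu X ((2 + \<epsilon>) * real sstar)"
    and map: "\<And>\<omega>. \<omega> \<in> space M \<Longrightarrow>
                is_arg_max (posterior X \<sigma> sbar lam (y \<omega>)) (\<lambda>_. True) (Jmap \<omega>)"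
  shows "\<exists>E \<in> sets M. measure M E \<ge> 1 - 7 * real CARD('p) powr (- c) \<and>
           (\<forall>\<omega>\<in>E. infnorm (beta_hat X (Jmap \<omega>) (y \<omega>) - bstar)
              \<le> \<sigma> * sqrt (2 * (c + 1) * ln (real CARD('p))
                              / (real CARD('n) * (nu X (real sstar))\<^sup>2)))"
proof -
  interpret prob_space M by (rule prob)
  let ?p = "real CARD('p)"
  let ?n = "real CARD('n)"
  define l where "l = ln ?p"
  define J0 where "J0 = vec_supp bstar"
  define s where "s = (2 + \<epsilon>) * real sstar"
  define \<mu> where "\<mu> = X *v bstar"
  have G: "(1 + \<epsilon>) / \<epsilon> * (23 + 5 * c) > 0" using eps c by simp
  \<comment> \<open>Positivity of \<open>lam\<close> forces \<open>ln p > 0\<close>, hence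
    \<open>p \<ge> 2\<close>.\<close>
  have l: "l > 0"
    using lam_pos G unfolding lam l_def by (rule zero_less_mult_pos)
  then have "CARD('p) > 1" by (simp add: l_def)
  then have p2: "?p \<ge> 2" by simp
  have p: "?p = exp l" using p2 by (simp add: l_def)
  have lam': "lam = (1 + \<epsilon>) / \<epsilon> * (23 + 5 * c) * l" by (simp add: lam l_def)
  have s_ge: "real sstar \<le> s" and s1: "1 \<le> s"
  proof -
    have "1 * real sstar \<le> s" unfolding s_def using eps by (intro mult_right_mono) auto
    then show "real sstar \<le> s" "1 \<le> s" using sstar_bounds by auto
  qed
  have I0: "condition_I X (real sstar)"
    using identifiable s_ge unfolding condition_I_def s_def by fastforce
  define \<nu> \<nu>0 where "\<nu> = nu X s" and "\<nu>0 = nu X (real sstar)"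
  have \<nu>: "\<nu> > 0" unfolding \<nu>_def using nu_pos identifiable s1 by (simp add: s_def)
  have \<nu>0: "\<nu>0 > 0" unfolding \<nu>0_def using nu_pos[OF I0] sstar_bounds by simp
  have \<mu>_in: "\<mu> \<in> col_space X J0" by (auto simp: \<mu>_def J0_def col_space_eq)

  obtain L where L: "linear L" "\<And>x. vec_supp (L x) \<subseteq> J0" "\<And>x. X *v L x = proj_cols X J0 x"
    "\<And>b. vec_supp b \<subseteq> J0 \<Longrightarrow> L (X *v b) = b" "\<And>x. norm (L x) \<le> norm x / (sqrt ?n * \<nu>0)"
    using matrix_left_inverse_coordinates[OF I0, of J0] sstar sstar_bounds(1)
    unfolding J0_def \<nu>0_def by auto
  \<comment> \<open>\<open>w j\<close> represents the \<open>j\<close>-th coordinate of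
    \<open>L\<close>, so on the true support the estimation error at \<open>j\<close> is the
    Gaussian variable \<open>w j \<bullet> z \<omega>\<close>.\<close>
  define w where "w j = adjoint L (axis j 1)" for j
  have w: "w j \<bullet> x = L x $ j" for j x
    by (simp add: w_def inner_commute[of _ x] adjoint_works[OF L(1)] inner_axis)
  \<comment> \<open>Duality: evaluating \<open>L\<close> at \<open>w j\<close> itself turns the norm
    bound on \<open>L\<close> into one on \<open>w j\<close>.\<close>
  have norm_w: "norm (w j) \<le> 1 / (sqrt ?n * \<nu>0)" for j
  proof (cases "w j = 0")
    case False
    have "norm (w j) * norm (w j) = L (w j) $ j"
      by (simp add: power2_norm_eq_inner w flip: power2_eq_square)
    also have "\<dots> \<le> norm (L (w j))"
      using component_le_norm_cart[of "L (w j)" j] by linarith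
    also have "\<dots> \<le> 1 / (sqrt ?n * \<nu>0) * norm (w j)" using L(5)[of "w j"] by simp
    finally show ?thesis
      by (rule mult_right_le_imp_le) (use False in simp)
  qed (use \<nu>0 in simp)

  \<comment> \<open>The orthonormal systems depend on \<open>T\<close> only, never on the noise, so
    each event below concerns a fixed quadratic form.\<close>
  have "\<exists>B. finite B \<and> pairwise orthogonal B \<and> (\<forall>e\<in>B. norm e = 1) \<and> card B \<le> card T \<and>
     (\<forall>x. (norm (x - proj_cols X J0 x))\<^sup>2
          = (norm (x - proj_cols X (J0 \<union> T) x))\<^sup>2 + (\<Sum>e\<in>B. (e \<bullet> x)\<^sup>2))" for T
    by (rule residual_orthonormal_increment[of T X J0]) blast
  then obtain B where B: "\<And>T. finite (B T)" "\<And>T. pairwise orthogonal (B T)"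
    "\<And>T e. e \<in> B T \<Longrightarrow> norm e = 1" "\<And>T. card (B T) \<le> card T"
    "\<And>T x. (norm (x - proj_cols X J0 x))\<^sup>2
          = (norm (x - proj_cols X (J0 \<union> T) x))\<^sup>2 + (\<Sum>e\<in>B T. (e \<bullet> x)\<^sup>2)"
    by metis
  define v where "v J = \<mu> - proj_cols X J \<mu>" for J
  \<comment> \<open>The events for \<open>J\<close> are indexed by its symmetric difference \<open>D\<close> with \<open>J0\<close>, so that the union
    bound is \<open>\<Sum>D\<noteq>{}. q ^ card D \<le> p\<^sup>2 q\<close>.\<close>
  define symdiff where "symdiff D = (J0 - D) \<union> (D - J0)" for D

  \<comment> \<open>Exceptional events and their probabilities\<close>
  have [measurable]: "z \<in> borel_measurable M" using noise by (rule isotropic_gaussian_measurable)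
  \<comment> \<open>The constants match the union bounds: rate \<open>c + 2\<close> for sums over
    subsets, an extra \<open>1 / 2\<close> in \<open>E1\<close> to pay
    \<open>sqrt 2 \<le> sqrt p\<close> per degree of freedom, and \<open>c + 1\<close> for the
    \<open>p\<close> coordinates in \<open>E3\<close>.\<close>
  define E1 where "E1 T = {\<omega> \<in> space M. (\<Sum>e\<in>B T. (e \<bullet> z \<omega>)\<^sup>2) > 4 * \<sigma>\<^sup>2 * ((c + 5 / 2) * real (card T) * l)}" for T
  define E2 where "E2 D = {\<omega> \<in> space M. \<bar>v (symdiff D) \<bullet> z \<omega>\<bar>
      > \<sigma> * norm (v (symdiff D)) * sqrt (2 * ((c + 2) * real (card D) * l))}" for D
  define E3 where "E3 j = {\<omega> \<in> space M. \<bar>w j \<bullet> z \<omega>\<bar> > \<sigma> * norm (w j) * sqrt (2 * ((c + 1) * l))}" for j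
  have [measurable]: "E1 T \<in> sets M" "E2 T \<in> sets M" "E3 j \<in> sets M" for T j
    unfolding E1_def E2_def E3_def by measurable
  \<comment> \<open>\<open>q\<close> is \<open>p powr - (c + 2)\<close>, so that
    \<open>p\<^sup>2 * q\<close> is \<open>p powr - c\<close>.\<close>
  define q where "q = exp (- (c + 2) * l)"
  have q: "0 \<le> q" "?p * q \<le> 1" "?p\<^sup>2 * q = exp (- c * l)"
  proof -
    have "?p * q = exp (- (c + 1) * l)"
      unfolding p q_def by (simp add: algebra_simps flip: exp_add)
    then show "?p * q \<le> 1" using c l by (simp add: mult_nonpos_nonneg)
    show "?p\<^sup>2 * q = exp (- c * l)"
      unfolding p q_def by (simp add: algebra_simps power2_eq_square flip: exp_add)
  qed (simp add: q_def)
  have sum_q: "(\<Sum>T | T \<noteq> ({} :: 'p set). q ^ card T) \<le> exp (- c * l)"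
    using sum_nonempty_subsets_power_le[OF q(1,2)] q(3) by simp
  have P1: "prob (E1 T) \<le> q ^ card T" for T
  proof -
    have "sqrt 2 \<le> exp (l / 2)"
    proof (rule real_le_lsqrt)
      show "2 \<le> (exp (l / 2))\<^sup>2" using p2 p by (simp flip: exp_double)
    qed auto
    then have "exp (- (c + 5 / 2) * l) * sqrt 2 \<le> exp (- (c + 5 / 2) * l) * exp (l / 2)" by simp
    also have "\<dots> = q" by (simp add: q_def algebra_simps flip: exp_add)
    finally have le: "exp (- (c + 5 / 2) * l) * sqrt 2 \<le> q" .
    have "prob (E1 T) \<le> exp (- ((c + 5 / 2) * real (card T) * l)) * sqrt 2 ^ card T"
      unfolding E1_def by (rule gaussian_squares_tail[OF prob noise sigma]) (use B in auto)
    also have "exp (- ((c + 5 / 2) * real (card T) * l)) = exp (- (c + 5 / 2) * l) ^ card T"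
      by (simp add: algebra_simps flip: exp_of_nat_mult)
    also have "\<dots> * sqrt 2 ^ card T \<le> q ^ card T"
      using le by (simp add: power_mono flip: power_mult_distrib)
    finally show ?thesis .
  qed
  have P2: "prob (E2 D) \<le> 2 * q ^ card D" if "D \<noteq> {}" for D
  proof -
    have "0 < card D" using that by (simp add: card_gt_0_iff)
    then have "prob (E2 D) \<le> 2 * exp (- ((c + 2) * real (card D) * l))"
      unfolding E2_def using c l by (intro gaussian_linear_tail[OF prob noise sigma]) auto
    also have "exp (- ((c + 2) * real (card D) * l)) = q ^ card D"
      by (simp add: q_def algebra_simps flip: exp_of_nat_mult)
    finally show ?thesis .
  qed
  have P3: "prob (E3 j) \<le> 2 * exp (- ((c + 1) * l))" for j
    unfolding E3_def using c l by (intro gaussian_linear_tail[OF prob noise sigma]) auto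
  define Bad where "Bad = ((\<Union>T\<in>{T. T \<noteq> {}}. E1 T) \<union> (\<Union>D\<in>{D. D \<noteq> {}}. E2 D)) \<union> (\<Union>j\<in>UNIV. E3 j)"
  have [measurable]: "Bad \<in> sets M"
    unfolding Bad_def by (intro sets.Un sets.finite_UN) auto
  \<comment> \<open>The three families cost 1 + 2 + 2 = 5 multiples of \<open>p powr - c\<close>,
    within the 7 allowed.\<close>
  have "prob Bad \<le> exp (- c * l) + 2 * exp (- c * l) + 2 * exp (- c * l)"
  proof -
    have U1: "prob (\<Union>T\<in>{T. T \<noteq> {}}. E1 T) \<le> exp (- c * l)"
      by (rule order_trans[OF measure_UN_le_sum sum_q]) (auto intro: P1)
    have "prob (\<Union>D\<in>{D. D \<noteq> {}}. E2 D) \<le> (\<Sum>D | D \<noteq> ({} :: 'p set). 2 * q ^ card D)"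
      by (rule measure_UN_le_sum) (auto intro: P2)
    also have "\<dots> \<le> 2 * exp (- c * l)" using sum_q by (simp flip: sum_distrib_left)
    finally have U2: "prob (\<Union>D\<in>{D. D \<noteq> {}}. E2 D) \<le> 2 * exp (- c * l)" .
    have "prob (\<Union>j\<in>UNIV. E3 j) \<le> (\<Sum>j\<in>(UNIV :: 'p set). 2 * exp (- ((c + 1) * l)))"
      by (rule measure_UN_le_sum) (auto intro: P3)
    also have "\<dots> = 2 * (?p * exp (- ((c + 1) * l)))" by simp
    also have "?p * exp (- ((c + 1) * l)) = exp (- c * l)"
      unfolding p by (simp add: algebra_simps flip: exp_add)
    finally have U3: "prob (\<Union>j\<in>UNIV. E3 j) \<le> 2 * exp (- c * l)" .
    have "prob Bad \<le> prob (\<Union>T\<in>{T. T \<noteq> {}}. E1 T) + prob (\<Union>D\<in>{D. D \<noteq> {}}. E2 D) + prob (\<Union>j\<in>UNIV. E3 j)"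
      unfolding Bad_def
      by (intro order_trans[OF measure_Un_le] add_mono measure_Un_le sets.Un sets.finite_UN) auto
    with U1 U2 U3 show ?thesis by linarith
  qed
  moreover have "?p powr - c = exp (- c * l)" "0 < exp (- c * l)"
    using p2 by (simp_all add: powr_def l_def)
  ultimately have prob_Bad: "prob Bad \<le> 7 * ?p powr - c"
    by linarith

  \<comment> \<open>Deterministic argument outside the exceptional events\<close>
  have good: "infnorm (beta_hat X (Jmap \<omega>) (y \<omega>) - bstar)
              \<le> \<sigma> * sqrt (2 * (c + 1) * ln ?p / (?n * (nu X (real sstar))\<^sup>2))"
    if \<omega>: "\<omega> \<in> space M - Bad" for \<omega>
  proof -
    have notE: "T \<noteq> {} \<Longrightarrow> \<omega> \<notin> E1 T" "T \<noteq> {} \<Longrightarrow> \<omega> \<notin> E2 T" "\<omega> \<notin> E3 j" "\<omega> \<in> space M" for T j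
      using \<omega> by (auto simp: Bad_def)
    have y: "y \<omega> = \<mu> + z \<omega>" using model \<omega> by (simp add: \<mu>_def)
    have sel: "Jmap \<omega> = J0"
    proof (rule ccontr)
      define J where "J = Jmap \<omega>"
      assume "Jmap \<omega> \<noteq> J0"
      then have ne: "J \<noteq> J0" by (simp add: J_def)
      define T where "T = J - J0"
      define K where "K = J0 - J"
      have cJ: "card J = card (J \<inter> J0) + card T" and c0: "sstar = card (J \<inter> J0) + card K"
        unfolding T_def K_def sstar J0_def[symmetric]
        by (simp_all add: card_Int_Diff[of J J0] card_Int_Diff[of J0 J] Int_commute)
      have cD: "card (T \<union> K) = card T + card K"
        by (intro card_Un_disjoint) (auto simp: T_def K_def)
      \<comment> \<open>\<open>symdiff\<close> is an involution, so the event indexed by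
        \<open>T \<union> K\<close> is the one about \<open>v J\<close>.\<close>
      have symdiffD: "symdiff (T \<union> K) = J" by (auto simp: symdiff_def T_def K_def)
      have D0: "T \<union> K \<noteq> {}" using ne by (auto simp: T_def K_def)
      define W where "W x = (\<Sum>e\<in>B T. (e \<bullet> x)\<^sup>2)" for x
      have W: "W (z \<omega>) \<le> 4 * \<sigma>\<^sup>2 * ((c + 5 / 2) * real (card T) * l)"
      \<comment> \<open>\<open>Bad\<close> does not include \<open>E1 {}\<close>; for empty
        \<open>T\<close> the system \<open>B T\<close> is empty and \<open>W\<close>
        vanishes.\<close>
      proof (cases "T = {}")
        case True
        then have "B T = {}" using B(1)[of T] B(4)[of T] by simp
        then show ?thesis using True by (simp add: W_def)
      next
        case False
        then have "\<omega> \<notin> E1 T" "\<omega> \<in> space M" using notE by simp_all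
        then show ?thesis by (simp add: E1_def W_def)
      qed
      have W_eq: "(norm (x - proj_cols X J0 x))\<^sup>2
          = (norm (x - proj_cols X (J0 \<union> (J - J0)) x))\<^sup>2 + W x" for x
        unfolding W_def T_def by (rule B(5))
      define D where "D = (norm (y \<omega> - proj_cols X J (y \<omega>)))\<^sup>2 - (norm (y \<omega> - proj_cols X J0 (y \<omega>)))\<^sup>2"
      have DW: "D \<ge> - W (z \<omega>)" "D \<ge> (norm (v J))\<^sup>2 + 2 * (v J \<bullet> z \<omega>) - W (z \<omega>)"
        unfolding D_def y v_def
        by (rule residual_difference_ge[OF \<mu>_in W_eq])+
      have cJ0: "card J0 = sstar" by (simp add: sstar J0_def)
      have "posterior X \<sigma> sbar lam (y \<omega>) J < posterior X \<sigma> sbar lam (y \<omega>) J0"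
      proof (cases "real (card J) > (1 + \<epsilon>) * real sstar")
        case True
        have "1 * real sstar \<le> (1 + \<epsilon>) * real sstar" using eps by (intro mult_right_mono) auto
        then have gt: "card J > sstar" using True by linarith
        have "real (card J) * l < lam * (real (card J) - real sstar) + D / (2 * \<sigma>\<^sup>2)"
          by (rule posterior_gap_overfit[OF sigma l eps c True _ _ _ lam' W DW(1)])
            (use gt cJ in auto)
        \<comment> \<open>As \<open>card J\<close> exceeds \<open>sstar\<close>, the crude choice
          \<open>h = card J\<close> bounds the difference of sizes.\<close>
        then show ?thesis
          using gt sstar_bounds by (intro posterior_less[where h = "card J"]) (auto simp: cJ0 D_def l_def)
      next
        case False
        \<comment> \<open>At most \<open>sstar\<close> indices are missing, so the union has at most
          \<open>(1 + \<epsilon>) * sstar + sstar = s\<close> elements, the range covered by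
          \<open>\<nu>\<close>.\<close>
        have "card (J \<union> J0) = card J + card K"
          unfolding K_def by (subst card_Un_disjoint[symmetric]) (auto intro: arg_cong[where f = card])
        then have "real (card (J \<union> J0)) \<le> s"
          using False c0 by (simp add: s_def algebra_simps)
        moreover define \<tau> where "\<tau> = 3 * \<sigma> * sqrt (lam / ?n) / \<nu>"
        moreover have "0 \<le> \<tau>" using sigma lam_pos \<nu> by (simp add: \<tau>_def)
        moreover have "\<tau> \<le> \<bar>bstar $ j\<bar>" if "j \<in> J0" for j
        proof -
          have "(MIN j\<in>J0. \<bar>bstar $ j\<bar>) \<le> \<bar>bstar $ j\<bar>" using that by simp
          with beta_min show ?thesis by (simp add: \<tau>_def \<nu>_def s_def J0_def)
        qed
        ultimately have "\<nu>\<^sup>2 * ?n * (real (card K) * \<tau>\<^sup>2) \<le> (norm (v J))\<^sup>2"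
          using signal_residual_ge[of J bstar s X \<tau>] \<nu> by (simp add: J0_def \<nu>_def K_def v_def \<mu>_def)
        \<comment> \<open>\<open>\<nu>\<^sup>2\<close> and \<open>n\<close> cancel, and the 3 of the
          signal condition becomes 9.\<close>
        moreover have "\<nu>\<^sup>2 * ?n * (real (card K) * \<tau>\<^sup>2) = 9 * \<sigma>\<^sup>2 * lam * real (card K)"
          using \<nu> lam_pos by (simp add: \<tau>_def power_divide power_mult_distrib)
        ultimately have m: "9 * \<sigma>\<^sup>2 * lam * real (card K) \<le> (norm (v J))\<^sup>2" by simp
        have "\<omega> \<notin> E2 (T \<union> K)" "\<omega> \<in> space M" using notE D0 by simp_all
        then have i: "\<bar>v J \<bullet> z \<omega>\<bar> \<le> \<sigma> * norm (v J) * sqrt (2 * ((c + 2) * (real (card T) + real (card K)) * l))"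
          by (simp add: E2_def symdiffD cD)
        have "0 < card (T \<union> K)" using D0 by (simp add: card_gt_0_iff)
        then have "(real (card T) + real (card K)) * l < lam * (real (card T) - real (card K)) + D / (2 * \<sigma>\<^sup>2)"
          by (intro posterior_gap_near[OF sigma l eps c _ _ _ lam' W DW(2) m i]) (auto simp: cD)
        then show ?thesis
          using sstar_bounds by (intro posterior_less[where h = "card T + card K"])
            (auto simp: cJ0 D_def l_def cJ c0)
      qed
      moreover have "\<not> posterior X \<sigma> sbar lam (y \<omega>) J < posterior X \<sigma> sbar lam (y \<omega>) J0"
        using map[of \<omega>] \<omega> by (simp add: is_arg_max_def J_def)
      ultimately show False by blast
    qed
    \<comment> \<open>\<open>L\<close> inverts \<open>X\<close> on vectors supported in
      \<open>J0\<close>, so on the right support only noise is left.\<close>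
    have "beta_hat X (Jmap \<omega>) (y \<omega>) - bstar = L (z \<omega>)"
    proof -
      have "beta_hat X (Jmap \<omega>) (y \<omega>) = L (y \<omega>)"
        unfolding sel by (rule beta_hat_eq[OF L(1-4)])
      also have "\<dots> = bstar + L (z \<omega>)"
        by (simp add: y linear_add[OF L(1)] \<mu>_def L(4) J0_def)
      finally show ?thesis by simp
    qed
    moreover have coord: "\<bar>L (z \<omega>) $ j\<bar> \<le> \<sigma> * sqrt (2 * (c + 1) * ln ?p / (?n * (nu X (real sstar))\<^sup>2))" for j
    proof -
      have "\<omega> \<notin> E3 j" "\<omega> \<in> space M" using notE by simp_all
      then have "\<bar>L (z \<omega>) $ j\<bar> \<le> \<sigma> * norm (w j) * sqrt (2 * ((c + 1) * l))"
        by (simp add: E3_def w)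
      also have "\<dots> \<le> \<sigma> * (1 / (sqrt ?n * \<nu>0)) * sqrt (2 * ((c + 1) * l))"
        using norm_w[of j] sigma c l by (intro mult_right_mono mult_left_mono) auto
      also have "\<dots> = \<sigma> * sqrt (2 * (c + 1) * l / (?n * \<nu>0\<^sup>2))"
      proof -
        have "sqrt (?n * \<nu>0\<^sup>2) = sqrt ?n * \<nu>0" using \<nu>0 by (simp add: real_sqrt_mult)
        then show ?thesis by (simp only: real_sqrt_divide mult.assoc) simp
      qed
      finally show ?thesis by (simp add: l_def \<nu>0_def)
    qed
    moreover have "infnorm (L (z \<omega>)) \<le> \<sigma> * sqrt (2 * (c + 1) * ln ?p / (?n * (nu X (real sstar))\<^sup>2))"
      unfolding infnorm_cart by (rule cSup_least) (use coord in blast)+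
    ultimately show ?thesis by (simp only:)
  qed
  \<comment> \<open>The witness is the complement of \<open>Bad\<close>, an event expressed through
    the noise \<open>z\<close> and hence measurable.\<close>
  have "prob (space M - Bad) \<ge> 1 - 7 * ?p powr - c"
    using prob_Bad prob_compl[of Bad] by simp
  moreover have "space M - Bad \<in> sets M" by simp
  ultimately show ?thesis
    using good by blast
qed

end
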